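(* For $n\le 8$, an $n$-dimensional (nonzero) indecomposable nilpotent pseudo-Hermitian quadratic Lie algebra is equivalent to one and only one of the following pseudo-Hermitian quadratic Lie algebras: $$\mathbb R^{0,2},\quad \mathbb R^{2,0},\quad \mathcal L^{4,2},\quad \mathcal L^{2,4},\quad T^*_0\mathfrak k,\quad T^*_{\theta_3}\mathfrak k.$$
   Context: All Lie algebras are real. A complex structure on a Lie algebra $\mathfrak g$ is a linear map $J:\mathfrak g\to\mathfrak g$ with $J^2=-I$ and $[x,y]+J[Jx,y]+J[x,Jy]-[Jx,Jy]=0$ for all $x,y$. A pseudo-Hermitian quadratic Lie algebra is a triple $(\mathfrak g,J,\varphi)$ where $J$ is a complex structure and $\varphi$ is a non-degenerate symmetric bilinear form with $\varphi([x,y],z)+\varphi(y,[x,z])=0$ and $\varphi(Jx,Jy)=\varphi(x,y)$ for all $x,y,z$. Two such triples are equivalent if there is a Lie algebra isomorphism $\psi:\mathfrak g_1\to\mathfrak g_2$ with $J_2\circ\psi=\psi\circ J_1$ and $\varphi_2(\psi x,\psi y)=\varphi_1(x,y)$. A pseudo-Hermitian quadratic Lie algebra is indecomposable if it does not split as an orthogonal direct sum of two nonzero pseudo-Hermitian quadratic ideals (i.e. $J$-invariant ideals on which $\varphi$ is non-degenerate). Signatures are written (number of negative squares, number of positive squares). The algebras (only nonzero brackets and pairings, up to skewsymmetry resp. symmetry, are listed; $J^2=-I$): $\mathbb R^{0,2}$, $\mathbb R^{2,0}$: the abelian Lie algebra $\mathbb R^2$ with a complex structure $J$ and a $J$-invariant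 positive definite, resp. negative definite, metric. $\mathcal L=\mathrm{span}_{\mathbb R}\{x_1,Jx_1,x_2,Jx_2,x_3,Jx_3\}$ with $[x_1,Jx_1]=x_2$, $[x_1,x_2]=-Jx_3$, $[Jx_1,x_2]=x_3$. One of $\mathcal L^{2,4},\mathcal L^{4,2}$ is $\mathcal L$ with the metric $\varphi(x_1,x_3)=\varphi(Jx_1,Jx_3)=1$, $\varphi(x_2,x_2)=\varphi(Jx_2,Jx_2)=1$ (of signature $(2,4)$), and the other one is $\mathcal L$ with the opposite metric $-\varphi$ (same complex structure). $T^*_0\mathfrak k$ and $T^*_{\theta_3}\mathfrak k$ have basis $\{x_1,x_2,x_3,x_4,x_1^*,x_2^*,x_3^*,x_4^*\}$, with $\varphi(x_i,x_j^* )=\delta_{ij}$, $\varphi(x_i,x_j)=\varphi(x_i^*,x_j^* )=0$, and $Jx_1=x_2$, $Jx_3=x_4$, $Jx_1^*=x_2^*$, $Jx_3^*=x_4^*$. The brackets are: for $T^*_0\mathfrak k$: $[x_1,x_2]=x_3$, $[x_3^*,x_1]=x_2^*$, $[x_3^*,x_2]=-x_1^*$; for $T^*_{\theta_3}\mathfrak k$: $[x_1,x_2]=x_3$, $[x_1,x_3]=x_4^*$, $[x_1,x_4]=-x_3^*$, $[x_3,x_4]=x_1^*$, $[x_3^*,x_1]=x_2^*$, $[x_3^*,x_2]=-x_1^*$. *)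

theory Defs
  imports "HOL-Analysis.Analysis"
begin

section \<open>Pseudo-Hermitian quadratic Lie algebras\<close>

text \<open>The underlying vector space is the whole type \<open>'a\<close>.\<close>

record 'a phq_algebra =
  bracket :: "'a \<Rightarrow> 'a \<Rightarrow> 'a"
  cstr :: "'a \<Rightarrow> 'a"
  metric :: "'a \<Rightarrow> 'a \<Rightarrow> real"

definition lie_bracket :: "('a::real_vector \<Rightarrow> 'a \<Rightarrow> 'a) \<Rightarrow> bool" where
  "lie_bracket br \<longleftrightarrow>
     bilinear br \<and>
     (\<forall>x. br x x = 0) \<and>
     (\<forall>x y z. br x (br y z) + br y (br z x) + br z (br x y) = 0)"

definition complex_structure :: "('a::real_vector \<Rightarrow> 'a \<Rightarrow> 'a) \<Rightarrow> ('a \<Rightarrow> 'a) \<Rightarrow> bool" where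
  "complex_structure br J \<longleftrightarrow>
     linear J \<and>
     (\<forall>x. J (J x) = - x) \<and>
     (\<forall>x y. br x y + J (br (J x) y) + J (br x (J y)) - br (J x) (J y) = 0)"

definition phq_lie_algebra :: "'a::real_vector phq_algebra \<Rightarrow> bool" where
  "phq_lie_algebra A \<longleftrightarrow>
     lie_bracket (bracket A) \<and>
     complex_structure (bracket A) (cstr A) \<and>
     bilinear (metric A) \<and>
     (\<forall>x y. metric A x y = metric A y x) \<and>
     (\<forall>x. (\<forall>y. metric A x y = 0) \<longrightarrow> x = 0) \<and>
     (\<forall>x y z. metric A (bracket A x y) z + metric A y (bracket A x z) = 0) \<and>
     (\<forall>x y. metric A (cstr A x) (cstr A y) = metric A x y)"

definition phq_equivalent ::
  "'a::real_vector phq_algebra \<Rightarrow> 'b::real_vector phq_algebra \<Rightarrow> bool" where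
  "phq_equivalent A B \<longleftrightarrow>
     (\<exists>\<psi>. linear \<psi> \<and> bij \<psi> \<and>
        (\<forall>x y. \<psi> (bracket A x y) = bracket B (\<psi> x) (\<psi> y)) \<and>
        (\<forall>x. cstr B (\<psi> x) = \<psi> (cstr A x)) \<and>
        (\<forall>x y. metric B (\<psi> x) (\<psi> y) = metric A x y))"

fun lower_central :: "'a::real_vector phq_algebra \<Rightarrow> nat \<Rightarrow> 'a set" where
  "lower_central A 0 = UNIV"
| "lower_central A (Suc k) = span {bracket A x y | x y. y \<in> lower_central A k}"

definition nilpotent :: "'a::real_vector phq_algebra \<Rightarrow> bool" where
  "nilpotent A \<longleftrightarrow> (\<exists>k. lower_central A k = {0})"

definition phq_ideal :: "'a::real_vector phq_algebra \<Rightarrow> 'a set \<Rightarrow> bool" where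
  "phq_ideal A I \<longleftrightarrow>
     subspace I \<and>
     (\<forall>x. \<forall>y\<in>I. bracket A x y \<in> I) \<and>
     (\<forall>x\<in>I. cstr A x \<in> I) \<and>
     (\<forall>x\<in>I. (\<forall>y\<in>I. metric A x y = 0) \<longrightarrow> x = 0)"

definition indecomposable :: "'a::real_vector phq_algebra \<Rightarrow> bool" where
  "indecomposable A \<longleftrightarrow>
     \<not> (\<exists>I K. phq_ideal A I \<and> phq_ideal A K \<and> I \<noteq> {0} \<and> K \<noteq> {0} \<and>
          (\<forall>x\<in>I. \<forall>y\<in>K. metric A x y = 0) \<and>
          I \<inter> K = {0} \<and> {x + y | x y. x \<in> I \<and> y \<in> K} = UNIV)"


section \<open>The algebras of the classification\<close>

text \<open>Each table lists the nonzero products of basis vectors in the basis $e_i=$ \<open>bas i\<close>: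
  an entry \<open>(i, j, w)\<close> of a bracket table means $[e_i,e_j]=w$ and $[e_j,e_i]=-w$;
  an entry \<open>(i, j)\<close> of a complex structure table means $Je_i=e_j$ and $Je_j=-e_i$;
  an entry \<open>(i, j)\<close> of a metric table means $\varphi(e_i,e_j)=\varphi(e_j,e_i)=1$
  (in particular $\varphi(e_i,e_i)=1$ if $i=j$).\<close>

abbreviation bas :: "'i::finite \<Rightarrow> real ^ 'i" where
  "bas i \<equiv> axis i 1"

definition bracket_of :: "('i::finite \<times> 'i \<times> (real ^ 'i)) list \<Rightarrow> real ^ 'i \<Rightarrow> real ^ 'i \<Rightarrow> real ^ 'i" where
  "bracket_of tab u v = (\<Sum>(i, j, w)\<leftarrow>tab. (u $ i * v $ j - u $ j * v $ i) *\<^sub>R w)"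

definition cstr_of :: "('i::finite \<times> 'i) list \<Rightarrow> real ^ 'i \<Rightarrow> real ^ 'i" where
  "cstr_of tab u = (\<Sum>(i, j)\<leftarrow>tab. u $ i *\<^sub>R bas j - u $ j *\<^sub>R bas i)"

definition metric_of :: "('i::finite \<times> 'i) list \<Rightarrow> real ^ 'i \<Rightarrow> real ^ 'i \<Rightarrow> real" where
  "metric_of tab u v =
     (\<Sum>(i, j)\<leftarrow>tab. if i = j then u $ i * v $ i else u $ i * v $ j + u $ j * v $ i)"

definition opposite :: "'a phq_algebra \<Rightarrow> 'a phq_algebra" where
  "opposite A = A \<lparr>metric := \<lambda>u v. - metric A u v\<rparr>"

text \<open>Signatures are (number of negative squares, number of positive squares).\<close>

definition R_0_2 :: "(real ^ 2) phq_algebra" where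
  "R_0_2 = \<lparr>bracket = \<lambda>u v. 0, cstr = cstr_of [(1, 2)], metric = metric_of [(1, 1), (2, 2)]\<rparr>"

definition R_2_0 :: "(real ^ 2) phq_algebra" where
  "R_2_0 = opposite R_0_2"

datatype l_index = X1 | JX1 | X2 | JX2 | X3 | JX3

lemma UNIV_l_index: "UNIV = {X1, JX1, X2, JX2, X3, JX3}"
  by (auto intro: l_index.exhaust)

instance l_index :: finite
  by standard (simp add: UNIV_l_index)

definition L_2_4 :: "(real ^ l_index) phq_algebra" where
  "L_2_4 = \<lparr>
     bracket = bracket_of [(X1, JX1, bas X2), (X1, X2, - bas JX3), (JX1, X2, bas X3)],
     cstr = cstr_of [(X1, JX1), (X2, JX2), (X3, JX3)],
     metric = metric_of [(X1, X3), (JX1, JX3), (X2, X2), (JX2, JX2)]\<rparr>"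

definition L_4_2 :: "(real ^ l_index) phq_algebra" where
  "L_4_2 = opposite L_2_4"

text \<open>\<open>Ti\<close> and \<open>Si\<close> stand for $x_i$ and $x_i^*$.\<close>

datatype t_index = T1 | T2 | T3 | T4 | S1 | S2 | S3 | S4

lemma UNIV_t_index: "UNIV = {T1, T2, T3, T4, S1, S2, S3, S4}"
  by (auto intro: t_index.exhaust)

instance t_index :: finite
  by standard (simp add: UNIV_t_index)

definition Tstar_0 :: "(real ^ t_index) phq_algebra" where
  "Tstar_0 = \<lparr>
     bracket = bracket_of [(T1, T2, bas T3), (S3, T1, bas S2), (S3, T2, - bas S1)],
     cstr = cstr_of [(T1, T2), (T3, T4), (S1, S2), (S3, S4)],
     metric = metric_of [(T1, S1), (T2, S2), (T3, S3), (T4, S4)]\<rparr>"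

definition Tstar_theta3 :: "(real ^ t_index) phq_algebra" where
  "Tstar_theta3 = \<lparr>
     bracket = bracket_of
       [(T1, T2, bas T3), (T1, T3, bas S4), (T1, T4, - bas S3), (T3, T4, bas S1),
        (S3, T1, bas S2), (S3, T2, - bas S1)],
     cstr = cstr_of [(T1, T2), (T3, T4), (S1, S2), (S3, S4)],
     metric = metric_of [(T1, S1), (T2, S2), (T3, S3), (T4, S4)]\<rparr>"

lemma forall_l_index: "(\<forall>i. P i) \<longleftrightarrow> P X1 \<and> P JX1 \<and> P X2 \<and> P JX2 \<and> P X3 \<and> P JX3"
  by (metis l_index.exhaust)

lemma forall_t_index:
  "(\<forall>i. P i) \<longleftrightarrow> P T1 \<and> P T2 \<and> P T3 \<and> P T4 \<and> P S1 \<and> P S2 \<and> P S3 \<and> P S4"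
  by (metis t_index.exhaust)

lemma bilinear_bracket_of: "bilinear (bracket_of tab)"
proof (induction tab)
  case Nil
  then show ?case by (simp add: bilinear_def bracket_of_def linear_iff)
next
  case (Cons a tab)
  obtain i j w where a: "a = (i, j, w)" by (cases a) auto
  have eq: "bracket_of (a # tab) u v =
      (u $ i * v $ j - u $ j * v $ i) *\<^sub>R w + bracket_of tab u v" for u v
    by (simp add: bracket_of_def a)
  show ?case
    using Cons by (simp add: bilinear_def linear_iff eq algebra_simps)
qed

lemma linear_cstr_of: "linear (cstr_of tab)"
proof (induction tab)
  case Nil
  then show ?case by (simp add: cstr_of_def linear_iff)
next
  case (Cons a tab)
  obtain i j where a: "a = (i, j)" by (cases a) auto
  have eq: "cstr_of (a # tab) u = (u $ i *\<^sub>R bas j - u $ j *\<^sub>R bas i) + cstr_of tab u" for u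
    by (simp add: cstr_of_def a)
  show ?case
    using Cons by (simp add: linear_iff eq algebra_simps)
qed

lemma bilinear_metric_of: "bilinear (metric_of tab)"
proof (induction tab)
  case Nil
  then show ?case by (simp add: bilinear_def metric_of_def linear_iff)
next
  case (Cons a tab)
  obtain i j where a: "a = (i, j)" by (cases a) auto
  have eq: "metric_of (a # tab) u v =
      (if i = j then u $ i * v $ i else u $ i * v $ j + u $ j * v $ i) + metric_of tab u v" for u v
    by (simp add: metric_of_def a)
  show ?case
    using Cons by (simp add: bilinear_def linear_iff eq algebra_simps)
qed

lemma phq_opposite: "phq_lie_algebra A \<Longrightarrow> phq_lie_algebra (opposite A)"
  unfolding phq_lie_algebra_def opposite_def
  by (auto simp: bilinear_def linear_iff algebra_simps) (smt (verit))+

lemma metric_nondegenerateI: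
  assumes "\<And>i u. metric A u (bas (d i)) = u $ i"
  shows "(\<forall>y. metric A x y = 0) \<longrightarrow> x = 0"
  using assms by (metis vec_eq_iff zero_index)

lemma phq_R_0_2: "phq_lie_algebra R_0_2"
proof -
  have "\<forall>i. \<forall>u. metric R_0_2 u (bas (id i)) = u $ i"
    by (simp add: forall_2 R_0_2_def metric_of_def axis_def)
  note nd = metric_nondegenerateI[OF this[rule_format]]
  show ?thesis
    unfolding phq_lie_algebra_def lie_bracket_def complex_structure_def
    by (intro conjI allI nd)
       (simp_all add: R_0_2_def linear_cstr_of bilinear_metric_of,
        simp_all add: cstr_of_def metric_of_def vec_eq_iff forall_2 axis_def bilinear_def
          linear_iff algebra_simps)
qed

lemma phq_L_2_4: "phq_lie_algebra L_2_4"
proof -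
  let ?d = "\<lambda>i. case i of X1 \<Rightarrow> X3 | JX1 \<Rightarrow> JX3 | X2 \<Rightarrow> X2 | JX2 \<Rightarrow> JX2 | X3 \<Rightarrow> X1 | JX3 \<Rightarrow> JX1"
  have "\<forall>i. \<forall>u. metric L_2_4 u (bas (?d i)) = u $ i"
    by (simp add: forall_l_index L_2_4_def metric_of_def axis_def)
  note nd = metric_nondegenerateI[OF this[rule_format]]
  show ?thesis
    unfolding phq_lie_algebra_def lie_bracket_def complex_structure_def
    by (intro conjI allI nd)
       (simp_all add: L_2_4_def linear_cstr_of bilinear_metric_of bilinear_bracket_of,
        simp_all add: bracket_of_def cstr_of_def metric_of_def vec_eq_iff forall_l_index
          axis_def algebra_simps)
qed

lemma phq_Tstar_0: "phq_lie_algebra Tstar_0"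
proof -
  let ?d = "\<lambda>i. case i of T1 \<Rightarrow> S1 | T2 \<Rightarrow> S2 | T3 \<Rightarrow> S3 | T4 \<Rightarrow> S4
                      | S1 \<Rightarrow> T1 | S2 \<Rightarrow> T2 | S3 \<Rightarrow> T3 | S4 \<Rightarrow> T4"
  have "\<forall>i. \<forall>u. metric Tstar_0 u (bas (?d i)) = u $ i"
    by (simp add: forall_t_index Tstar_0_def metric_of_def axis_def)
  note nd = metric_nondegenerateI[OF this[rule_format]]
  show ?thesis
    unfolding phq_lie_algebra_def lie_bracket_def complex_structure_def
    by (intro conjI allI nd)
       (simp_all add: Tstar_0_def linear_cstr_of bilinear_metric_of bilinear_bracket_of,
        simp_all add: bracket_of_def cstr_of_def metric_of_def vec_eq_iff forall_t_index
          axis_def algebra_simps)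
qed

lemma phq_Tstar_theta3: "phq_lie_algebra Tstar_theta3"
proof -
  let ?d = "\<lambda>i. case i of T1 \<Rightarrow> S1 | T2 \<Rightarrow> S2 | T3 \<Rightarrow> S3 | T4 \<Rightarrow> S4
                      | S1 \<Rightarrow> T1 | S2 \<Rightarrow> T2 | S3 \<Rightarrow> T3 | S4 \<Rightarrow> T4"
  have "\<forall>i. \<forall>u. metric Tstar_theta3 u (bas (?d i)) = u $ i"
    by (simp add: forall_t_index Tstar_theta3_def metric_of_def axis_def)
  note nd = metric_nondegenerateI[OF this[rule_format]]
  show ?thesis
    unfolding phq_lie_algebra_def lie_bracket_def complex_structure_def
    by (intro conjI allI nd)
       (simp_all add: Tstar_theta3_def linear_cstr_of bilinear_metric_of bilinear_bracket_of,
        simp_all add: bracket_of_def cstr_of_def metric_of_def vec_eq_iff forall_t_index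
          axis_def algebra_simps)
qed

lemmas phq_R_2_0 = phq_opposite[OF phq_R_0_2, folded R_2_0_def]
lemmas phq_L_4_2 = phq_opposite[OF phq_L_2_4, folded L_4_2_def]

end

theory Submission
  imports Defs
begin

text \<open>
Why the classification holds. The complexification of the Lie algebra is $V \oplus \bar V$ with $V$ the
$i$-eigenspace of $J$. Integrability of $J$ makes $V$ a complex Lie algebra and the $J$-invariant metric
makes $(V,\bar V)$ a Manin triple. Everything is therefore encoded in a nilpotent complex Lie algebra $V$ of
dimension at most four with a Hermitian form $h$, subject to one compatibility condition
(\<open>manin\<close> below, a form of the Jacobi identity). Conversely the real bracket is recovered from the
product of $V$ and the metric (\<open>twice_bracket\<close>), so it is enough to bring $(V,h)$ to a normal form.

If $V$ is abelian, indecomposability leaves a single line, and its sign distinguishes the two flat planes.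
If all products are central, then $V$ is a Heisenberg algebra with centre $Cz$, possibly plus one more
central vector $r$. Compatibility forces $h(z,z) = 0$ and $h(r,z) = 0$, and $h(r,r) = 0$ since $r$ would
otherwise split off. In dimension three the sign of $h$ on the orthogonal complement of $z$ modulo $z$
survives (\<open>heisenberg3\<close>), in dimension four the centre is Lagrangian and no invariant is left
(\<open>heisenberg4\<close>).

If some product is not central, then $V$ is filiform (\<open>filiform_basis\<close>), with basis $e$, $f_2$,
$f_3 = e \star f_2$, $f_4 = e \star f_3$. The abelian ideal spanned by the $f_i$ is the orthogonal complement of a vector
$t$; compatibility forces $t$ to be a multiple of $f_4$ (\<open>f4_orthogonal\<close>) and then $h(f_3,f_3) = 0$.
So $f_3, f_4$ span a Lagrangian subspace and scaling reaches the single normal form (\<open>filiform4\<close>).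

The models are told apart by the dimension, by the sign of $g$ on the flat planes, by the sign of
$g([x,y],[x,y])$ in dimension six, and by the nilpotency class in dimension eight.
\<close>

section \<open>Complex products with a compatible Hermitian form\<close>

text \<open>The algebraic core of a pseudo-Hermitian quadratic Lie algebra. Let $V$ be the $i$-eigenspace of $J$ in the
complexification. Integrability makes $V$ a complex Lie algebra, with product \<open>\<star>\<close>; invariance
of the metric under $J$ makes $V$ and $\bar V$ isotropic and in duality, which is the Hermitian form
\<open>h\<close>. Invariance under the bracket determines the mixed brackets: the $V$-component of
$[x,\bar w]$ is \<open>co x w\<close>, the $h$-adjoint of $w \star {-}$ applied to $x$. The axiom
\<open>manin\<close> is what the Jacobi identity says about two arguments in $V$ and one in $\bar V$, paired
with a second vector of $\bar V$; it is the compatibility condition of the Manin triple $(V,\bar V)$.\<close>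

locale hermitian_lie = vector_space scale
  for scale :: "complex \<Rightarrow> 'v::ab_group_add \<Rightarrow> 'v" (infixr "\<odot>" 75) +
  fixes br :: "'v \<Rightarrow> 'v \<Rightarrow> 'v" (infixl "\<star>" 70)
    and co :: "'v \<Rightarrow> 'v \<Rightarrow> 'v"
    and h :: "'v \<Rightarrow> 'v \<Rightarrow> complex"
  assumes br_add_left: "(x + y) \<star> z = x \<star> z + y \<star> z"
    and br_scale_left: "(c \<odot> x) \<star> y = c \<odot> (x \<star> y)"
    and br_skew: "y \<star> x = - (x \<star> y)"
    and br_self [simp]: "x \<star> x = 0"
    and h_add_left: "h (x + y) z = h x z + h y z"
    and h_scale_left: "h (c \<odot> x) y = c * h x y"
    and h_sym: "h y x = cnj (h x y)"
    and h_nondegenerate: "(\<And>y. h x y = 0) \<Longrightarrow> x = 0"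
    and h_co: "h (co x w) y = h x (w \<star> y)"
    and manin: "h (u \<star> v) (w \<star> y) =
       h (co v w) (co y u) - h (co u w) (co y v) + h (co u y) (co w v) - h (co v y) (co w u)"
begin

lemma br_add_right: "z \<star> (x + y) = z \<star> x + z \<star> y"
  by (metis add.commute br_add_left br_skew minus_add)

lemma br_scale_right: "x \<star> (c \<odot> y) = c \<odot> (x \<star> y)"
  by (metis br_scale_left br_skew scale_minus_right)

lemma br_zero [simp]: "0 \<star> x = 0" "x \<star> 0 = 0"
  using br_scale_left[of 0 0 x] br_scale_right[of x 0 0] by simp_all

lemma br_minus: "(- x) \<star> y = - (x \<star> y)" "x \<star> (- y) = - (x \<star> y)"
  using br_scale_left[of "-1" x y] br_scale_right[of x "-1" y] by simp_all

lemma br_diff: "(x - y) \<star> z = x \<star> z - y \<star> z" "z \<star> (x - y) = z \<star> x - z \<star> y"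
  using br_add_left[of x "- y" z] br_add_right[of z x "- y"] by (simp_all add: br_minus)

lemmas br_expand = br_add_left br_add_right br_scale_left br_scale_right br_minus br_diff

lemma h_add_right: "h z (x + y) = h z x + h z y"
  by (metis complex_cnj_add h_add_left h_sym)

lemma h_scale_right: "h x (c \<odot> y) = cnj c * h x y"
  by (metis complex_cnj_mult h_scale_left h_sym)

lemma h_zero [simp]: "h 0 x = 0" "h x 0 = 0"
  using h_scale_left[of 0 0 x] h_scale_right[of x 0 0] by simp_all

lemma h_minus: "h (- x) y = - h x y" "h x (- y) = - h x y"
  using h_scale_left[of "-1" x y] h_scale_right[of x "-1" y] by simp_all

lemma h_diff: "h (x - y) z = h x z - h y z" "h z (x - y) = h z x - h z y"
  using h_add_left[of x "- y" z] h_add_right[of z x "- y"] by (simp_all add: h_minus)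

lemmas h_expand = h_add_left h_add_right h_scale_left h_scale_right h_minus h_diff

lemma h_zero_sym: "h x y = 0 \<longleftrightarrow> h y x = 0"
  by (metis complex_cnj_zero h_sym)

lemma h_self_real: "cnj (h x x) = h x x"
  using h_sym by metis

lemma co_eq_0I: "(\<And>y. h x (w \<star> y) = 0) \<Longrightarrow> co x w = 0"
  by (rule h_nondegenerate) (simp add: h_co)

lemma span3_iff: "x \<in> span {a, b, c} \<longleftrightarrow> (\<exists>k1 k2 k3. x = k1 \<odot> a + k2 \<odot> b + k3 \<odot> c)"
  by (simp add: span_insert algebra_simps eq_diff_eq diff_eq_eq)

lemma span4_iff: "x \<in> span {a, b, c, d} \<longleftrightarrow>
    (\<exists>k1 k2 k3 k4. x = k1 \<odot> a + k2 \<odot> b + k3 \<odot> c + k4 \<odot> d)"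
proof -
  have "x \<in> span {a, b, c, d} \<longleftrightarrow> (\<exists>k1 k2 k3 k4. x - k1 \<odot> a = k2 \<odot> b + k3 \<odot> c + k4 \<odot> d)"
    by (simp add: span_insert[of a] span3_iff)
  then show ?thesis by (simp add: diff_eq_eq add_ac)
qed

definition spanned3 where "spanned3 a b c \<longleftrightarrow> span {a, b, c} = UNIV"

definition spanned4 where "spanned4 a b c d \<longleftrightarrow> span {a, b, c, d} = UNIV"

lemma spanned3_iff:
  "spanned3 a b c \<longleftrightarrow> (\<forall>x. \<exists>k1 k2 k3. x = k1 \<odot> a + k2 \<odot> b + k3 \<odot> c)"
  unfolding spanned3_def by (auto simp: set_eq_iff simp flip: span3_iff)

lemma spanned4_iff:
  "spanned4 a b c d \<longleftrightarrow> (\<forall>x. \<exists>k1 k2 k3 k4. x = k1 \<odot> a + k2 \<odot> b + k3 \<odot> c + k4 \<odot> d)"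
  unfolding spanned4_def by (auto simp: set_eq_iff simp flip: span4_iff)

definition indep4 where
  "indep4 a b c d \<longleftrightarrow> (\<forall>k1 k2 k3 k4. k1 \<odot> a + k2 \<odot> b + k3 \<odot> c + k4 \<odot> d = 0 \<longrightarrow>
     k1 = 0 \<and> k2 = 0 \<and> k3 = 0 \<and> k4 = 0)"

lemma nondegenerate4:
  assumes "spanned4 a b c d" "h x a = 0" "h x b = 0" "h x c = 0" "h x d = 0"
  shows "x = 0"
proof (rule h_nondegenerate)
  fix y
  obtain k1 k2 k3 k4 where "y = k1 \<odot> a + k2 \<odot> b + k3 \<odot> c + k4 \<odot> d"
    using assms(1) unfolding spanned4_iff by blast
  then show "h x y = 0" using assms by (simp add: h_expand)
qed

lemma nondegenerate3:
  assumes "spanned3 a b c" "h x a = 0" "h x b = 0" "h x c = 0"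
  shows "x = 0"
proof (rule h_nondegenerate)
  fix y
  obtain k1 k2 k3 where "y = k1 \<odot> a + k2 \<odot> b + k3 \<odot> c"
    using assms(1) unfolding spanned3_iff by blast
  then show "h x y = 0" using assms by (simp add: h_expand)
qed

lemma span_UNIV_mono: "span S = UNIV \<Longrightarrow> S \<subseteq> span T \<Longrightarrow> span T = UNIV"
  by (metis span_mono span_span top.extremum_uniqueI)

text \<open>A change of the pair $(a,b)$ by a matrix of determinant one preserves the product $z$ and can move the
functional $h(-,z)$ to the first vector.\<close>

lemma adapted_pair:
  assumes ab: "a \<star> b = z" and "h a z \<noteq> 0 \<or> h b z \<noteq> 0"
  obtains a1 b1 where "h a1 z \<noteq> 0" "h b1 z = 0" "a1 \<star> b1 = z"
    "a \<in> span {a1, b1}" "b \<in> span {a1, b1}"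
proof (cases "h a z = 0")
  case True
  have "a = (- 1) \<odot> (- a)" by simp
  then have "a \<in> span {b, - a}" by (metis insertCI span_base span_scale)
  moreover have "b \<in> span {b, - a}" by (rule span_base) simp
  ultimately show ?thesis
    using that[of b "- a"] True assms br_skew[of b a] by (simp add: h_minus br_minus)
next
  case False
  define c where "c = h b z / h a z"
  have "a \<in> span {a, b - c \<odot> a}" by (rule span_base) simp
  moreover from this have "b \<in> span {a, b - c \<odot> a}"
    by (metis diff_add_cancel insertCI span_add span_base span_scale)
  ultimately show ?thesis
    using that[of a "b - c \<odot> a"] False ab by (simp add: c_def h_expand br_expand)
qed

text \<open>Hyperbolic completion: a vector that pairs with an isotropic one becomes isotropic after a shift along it.\<close>

lemma isotropic_shift:
  assumes "h z z = 0" "h x z \<noteq> 0"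
  obtains k where "h (x + k \<odot> z) (x + k \<odot> z) = 0"
proof
  define k where "k = cnj (- h x x / (2 * h x z))"
  have "h z x = cnj (h x z)" by (rule h_sym)
  moreover have "cnj k * h x z = - h x x / 2" "k * cnj (h x z) = - h x x / 2"
    using assms(2) h_self_real[of x] by (simp_all add: k_def)
  ultimately show "h (x + k \<odot> z) (x + k \<odot> z) = 0"
    using assms(1) by (simp add: h_expand algebra_simps)
qed

text \<open>Nested products themselves rather than their spans, so that the last layer outside the centre is seen to contain a
single product \<open>p \<star> q\<close> that is not central.\<close>

fun left_normed :: "nat \<Rightarrow> 'v set" where
  "left_normed 0 = UNIV"
| "left_normed (Suc k) = {x \<star> y | x y. y \<in> left_normed k}"

lemma last_noncentral_bracket:
  assumes nil: "left_normed n \<subseteq> {0}" and "u \<star> (v \<star> w) \<noteq> 0"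
  obtains p q x where "x \<star> (p \<star> q) \<noteq> 0" "\<And>v x. v \<star> (x \<star> (p \<star> q)) = 0"
proof -
  define C where "C k \<longleftrightarrow> (\<forall>y\<in>left_normed k. \<forall>x. x \<star> y = 0)" for k
  have "C n" using nil by (auto simp: C_def)
  define N where "N = (LEAST k. C k)"
  have CN: "C N" unfolding N_def using \<open>C n\<close> by (rule LeastI)
  have "\<not> C 0" "\<not> C 1" using assms(2) by (force simp: C_def)+
  then obtain M where M: "N = Suc (Suc M)" using CN by (metis One_nat_def not0_implies_Suc)
  then have "\<not> C (Suc M)" unfolding N_def by (intro not_less_Least) simp
  then obtain y x where "y \<in> left_normed (Suc M)" "x \<star> y \<noteq> 0" by (auto simp: C_def)
  moreover then obtain p q where "y = p \<star> q" by auto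
  moreover have "v \<star> (x \<star> y) = 0" for v x
  proof -
    have "x \<star> y \<in> left_normed N"
      unfolding M left_normed.simps(2)[of "Suc M"] using \<open>y \<in> left_normed (Suc M)\<close> by blast
    then show ?thesis using CN unfolding C_def by blast
  qed
  ultimately show ?thesis using that by blast
qed

end

section \<open>Adapted bases in complex dimension at most four\<close>

text \<open>The bound on the dimension enters only through the fact that four independent vectors span. The other
axiom is what indecomposability amounts to here: a non-isotropic vector that is central and orthogonal to
all products spans an ideal that splits off.\<close>

locale small_hermitian_lie = hermitian_lie scale br co h
  for scale :: "complex \<Rightarrow> 'v::ab_group_add \<Rightarrow> 'v" (infixr "\<odot>" 75)
    and br (infixl "\<star>" 70) and co h +
  assumes dim_le_4: "indep4 a b c d \<Longrightarrow> spanned4 a b c d"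
    and no_summand: "\<lbrakk>h r r \<noteq> 0; \<And>x. r \<star> x = 0; \<And>x y. h r (x \<star> y) = 0\<rbrakk> \<Longrightarrow> \<exists>k. x = k \<odot> r"
begin

text \<open>A Gram matrix that is invertible forces independence, so the four-dimensional normalisations never
have to track spans.\<close>

lemma hyperbolic_basis:
  assumes "h e1 e1 = 0" "h e1 e2 = 0" "h e1 e3 = 1" "h e1 e4 = 0" "h e2 e2 = 0" "h e2 e3 = 0"
    "h e2 e4 = 1" "h e3 e3 = 0" "h e3 e4 = 0" "h e4 e4 = 0"
  shows "spanned4 e1 e2 e3 e4"
proof (rule dim_le_4)
  have s: "h e2 e1 = 0" "h e3 e1 = 1" "h e4 e1 = 0" "h e3 e2 = 0" "h e4 e2 = 1" "h e4 e3 = 0"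
    using assms h_sym by (metis complex_cnj_zero complex_cnj_one)+
  show "indep4 e1 e2 e3 e4"
    unfolding indep4_def
  proof (intro allI impI)
    fix k1 k2 k3 k4
    assume e: "k1 \<odot> e1 + k2 \<odot> e2 + k3 \<odot> e3 + k4 \<odot> e4 = 0"
    have "h (k1 \<odot> e1 + k2 \<odot> e2 + k3 \<odot> e3 + k4 \<odot> e4) e3 = k1"
      "h (k1 \<odot> e1 + k2 \<odot> e2 + k3 \<odot> e3 + k4 \<odot> e4) e4 = k2"
      "h (k1 \<odot> e1 + k2 \<odot> e2 + k3 \<odot> e3 + k4 \<odot> e4) e1 = k3"
      "h (k1 \<odot> e1 + k2 \<odot> e2 + k3 \<odot> e3 + k4 \<odot> e4) e2 = k4"
      by (simp_all add: h_expand assms s)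
    then show "k1 = 0 \<and> k2 = 0 \<and> k3 = 0 \<and> k4 = 0" unfolding e by simp
  qed
qed

text \<open>Every non-isotropic vector splits off, and a nonzero Hermitian form has one by polarisation.\<close>

lemma abelian_basis:
  assumes "\<And>x y. x \<star> y = 0" "\<exists>x::'v. x \<noteq> 0"
  obtains e \<epsilon> where "\<epsilon> = 1 \<or> \<epsilon> = - 1" "h e e = of_real \<epsilon>" "\<And>x. \<exists>k. x = k \<odot> e"
proof -
  have "\<exists>r. h r r \<noteq> 0"
  proof (rule ccontr)
    assume "\<not> ?thesis"
    then have iso: "h x x = 0" for x by simp
    have "h x y = 0" for x y
    proof -
      have "h x y + h y x = 0" using iso[of "x + y"] by (simp add: h_expand iso[of x] iso[of y] add.commute)
      moreover have "\<i> * h y x - \<i> * h x y = 0" using iso[of "x + \<i> \<odot> y"] by (simp add: h_expand iso[of x] iso[of y])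
      ultimately show ?thesis by (simp add: algebra_simps)
    qed
    then show False using h_nondegenerate assms(2) by blast
  qed
  then obtain r where r: "h r r \<noteq> 0" by blast
  define B where "B = Re (h r r)"
  have hB: "h r r = of_real B"
    unfolding B_def using h_self_real[of r] by (simp add: complex_eq_iff)
  have B0: "B \<noteq> 0" using r hB by auto
  define s where "s = 1 / sqrt \<bar>B\<bar>"
  have s: "s \<noteq> 0" "s * s * B = sgn B" using B0 by (simp_all add: s_def sgn_if)
  define e where "e = of_real s \<odot> r"
  show ?thesis
  proof (rule that[of "sgn B" e])
    show "sgn B = 1 \<or> sgn B = - 1" using B0 by (simp add: sgn_if)
    have "h e e = of_real (s * s * B)" by (simp add: e_def h_expand hB)
    then show "h e e = of_real (sgn B)" unfolding s(2) .
    fix x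
    obtain k where "x = k \<odot> r" using no_summand[OF r] assms(1) by fastforce
    then have "x = (k / of_real s) \<odot> e" using s by (simp add: e_def)
    then show "\<exists>k. x = k \<odot> e" ..
  qed
qed

section \<open>Two-step nilpotent products\<close>

context
  fixes a b z
  assumes two_step: "\<And>v x y. v \<star> (x \<star> y) = 0"
    and ab: "a \<star> b = z" and z0: "z \<noteq> 0"
begin

lemma br_b_a: "b \<star> a = - z" using ab br_skew[of b a] by simp

lemma z_central: "x \<star> z = 0" "z \<star> x = 0"
  using two_step ab br_skew[of z x] by auto

text \<open>A product independent of $z$ would, together with $z$, $a$ and $b$, form a basis with two central members;
then every product is a multiple of $a \star b = z$ after all.\<close>

lemma br_multiple: "\<exists>k. p \<star> q = k \<odot> z"
proof (rule ccontr)
  define c where "c = p \<star> q"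
  assume "\<not> ?thesis"
  then have nc: "c \<noteq> k \<odot> z" for k by (auto simp: c_def)
  have cc: "x \<star> c = 0" "c \<star> x = 0" for x
    using two_step br_skew[of c x] by (auto simp: c_def)
  have "indep4 z c a b"
    unfolding indep4_def
  proof (intro allI impI)
    fix k1 k2 k3 k4
    assume e: "k1 \<odot> z + k2 \<odot> c + k3 \<odot> a + k4 \<odot> b = 0"
    have "(k1 \<odot> z + k2 \<odot> c + k3 \<odot> a + k4 \<odot> b) \<star> b = k3 \<odot> z"
      by (simp add: br_expand ab cc z_central)
    with e z0 have k3: "k3 = 0" by (simp add: scale_eq_0_iff)
    have "a \<star> (k1 \<odot> z + k2 \<odot> c + k3 \<odot> a + k4 \<odot> b) = k4 \<odot> z"
      by (simp add: br_expand ab cc z_central)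
    with e z0 have k4: "k4 = 0" by (simp add: scale_eq_0_iff)
    have e': "k1 \<odot> z + k2 \<odot> c = 0" using e k3 k4 by simp
    have k2: "k2 = 0"
    proof (rule ccontr)
      assume "k2 \<noteq> 0"
      then have "c = (1 / k2) \<odot> (k2 \<odot> c)" by simp
      also have "k2 \<odot> c = (- k1) \<odot> z" using e' by (simp add: eq_neg_iff_add_eq_0 add.commute)
      finally show False using nc[of "- (k1 / k2)"] by simp
    qed
    with e' z0 k3 k4 show "k1 = 0 \<and> k2 = 0 \<and> k3 = 0 \<and> k4 = 0" by simp
  qed
  then have sp: "spanned4 z c a b" by (rule dim_le_4)
  obtain p1 p2 p3 p4 where p: "p = p1 \<odot> z + p2 \<odot> c + p3 \<odot> a + p4 \<odot> b"
    using sp unfolding spanned4_iff by blast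
  obtain q1 q2 q3 q4 where q: "q = q1 \<odot> z + q2 \<odot> c + q3 \<odot> a + q4 \<odot> b"
    using sp unfolding spanned4_iff by blast
  have "p \<star> q = (p3 * q4 - p4 * q3) \<odot> z"
    unfolding p q by (simp add: br_expand ab br_b_a cc z_central algebra_simps)
  with nc show False unfolding c_def by blast
qed

text \<open>If $z$ were not isotropic, $a$ and $b$ could be moved into the orthogonal complement of $z$, where all
adjoints vanish on them because products are multiples of $z$; then the compatibility condition leaves only
$h(z,z) = 0$.\<close>

lemma commutator_isotropic: "h z z = 0"
proof (rule ccontr)
  assume nz: "h z z \<noteq> 0"
  define a' where "a' = a - (h a z / h z z) \<odot> z"
  define b' where "b' = b - (h b z / h z z) \<odot> z"
  have "a' \<star> b' = z" by (simp add: a'_def b'_def br_expand z_central ab)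
  moreover have o: "h a' z = 0" "h b' z = 0" using nz by (simp_all add: a'_def b'_def h_expand)
  have "co a' w = 0" "co b' w = 0" for w
    by (rule co_eq_0I; metis br_multiple h_scale_right o mult_zero_right)+
  ultimately have "h z z = 0" using manin[of a' b' a' b'] by simp
  with nz show False by simp
qed

text \<open>The form $\omega$ in $x \star y = \omega(x,y) z$ is nondegenerate on the span of $a$ and $b$, so a
fourth basis vector can be corrected to be $\omega$-orthogonal to both.\<close>

lemma central_complement:
  assumes "\<not> spanned3 a b z"
  obtains r where "spanned4 a b z r" "\<And>x. r \<star> x = 0" "\<And>k. r \<noteq> k \<odot> z"
proof -
  obtain g where g: "\<And>k1 k2 k3. g \<noteq> k1 \<odot> a + k2 \<odot> b + k3 \<odot> z"
    using assms unfolding spanned3_iff by blast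
  obtain l m where l: "a \<star> g = l \<odot> z" and m: "b \<star> g = m \<odot> z" using br_multiple by metis
  have gb: "g \<star> b = - m \<odot> z" "g \<star> a = - l \<odot> z"
    using l m br_skew[of g b] br_skew[of g a] by simp_all
  define r where "r = g + m \<odot> a - l \<odot> b"
  have ra: "r \<star> a = 0" "r \<star> b = 0"
    by (simp_all add: r_def br_expand gb ab br_b_a)
  have gr: "g = (- m) \<odot> a + l \<odot> b + r" by (simp add: r_def)
  have nr: "r \<noteq> k1 \<odot> a + k2 \<odot> b + k3 \<odot> z" for k1 k2 k3
  proof
    assume "r = k1 \<odot> a + k2 \<odot> b + k3 \<odot> z"
    then have "g = (k1 - m) \<odot> a + (k2 + l) \<odot> b + k3 \<odot> z"
      using gr by (simp add: algebra_simps)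
    then show False using g by blast
  qed
  have "indep4 a b z r"
    unfolding indep4_def
  proof (intro allI impI)
    fix k1 k2 k3 k4
    assume e: "k1 \<odot> a + k2 \<odot> b + k3 \<odot> z + k4 \<odot> r = 0"
    have k4: "k4 = 0"
    proof (rule ccontr)
      assume n: "k4 \<noteq> 0"
      then have "r = (1 / k4) \<odot> (k4 \<odot> r)" by simp
      also have "k4 \<odot> r = - (k1 \<odot> a + k2 \<odot> b + k3 \<odot> z)" using e by (metis add_eq_0_iff)
      finally have "r = (- k1 / k4) \<odot> a + (- k2 / k4) \<odot> b + (- k3 / k4) \<odot> z"
        by (simp add: algebra_simps)
      with nr show False by blast
    qed
    have "(k1 \<odot> a + k2 \<odot> b + k3 \<odot> z + k4 \<odot> r) \<star> b = k1 \<odot> z"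
      by (simp add: br_expand ab ra z_central)
    with e z0 have k1: "k1 = 0" by (simp add: scale_eq_0_iff)
    have "(k1 \<odot> a + k2 \<odot> b + k3 \<odot> z + k4 \<odot> r) \<star> a = (- k2) \<odot> z"
      by (simp add: br_expand br_b_a ra z_central)
    with e z0 have k2: "k2 = 0" by (simp add: scale_eq_0_iff)
    show "k1 = 0 \<and> k2 = 0 \<and> k3 = 0 \<and> k4 = 0" using e k1 k2 k4 z0 by simp
  qed
  then have sp: "spanned4 a b z r" by (rule dim_le_4)
  have "r \<star> x = 0" for x
  proof -
    obtain k1 k2 k3 k4 where "x = k1 \<odot> a + k2 \<odot> b + k3 \<odot> z + k4 \<odot> r"
      using sp unfolding spanned4_iff by blast
    then show ?thesis by (simp add: br_expand ra z_central)
  qed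
  moreover have "r \<noteq> k \<odot> z" for k using nr[of 0 0 k] by simp
  ultimately show ?thesis using that sp by blast
qed

text \<open>For central $r$ the compatibility condition with arguments $r, v, r, y$ says that the vectors
\<open>co r v\<close> span a totally isotropic space. If $h(r,z) \neq 0$ this makes them central, hence
combinations of $z$ and $r$; but they are orthogonal to these, so they vanish, which contradicts
$h(r, a \star b) \neq 0$.\<close>

lemma central_orthogonal_commutator:
  assumes sp: "spanned4 a b z r" and r: "\<And>x. r \<star> x = 0"
  shows "h r z = 0"
proof (rule ccontr)
  assume rz: "h r z \<noteq> 0"
  have zr: "h z r \<noteq> 0" using rz h_zero_sym by blast
  have r': "x \<star> r = 0" for x using r br_skew[of x r] by simp
  have cor: "co x r = 0" for x by (rule co_eq_0I) (simp add: r)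
  have "co r v = 0" for v
  proof -
    define x where "x = co r v"
    have "h r (y \<star> x) = 0" for y
      using manin[of r v r y] by (simp add: r cor h_co x_def)
    then have yx: "y \<star> x = 0" for y
      using rz br_multiple[of y x] by (metis complex_cnj_zero_iff h_scale_right mult_eq_0_iff scale_zero_left)
    obtain k1 k2 k3 k4 where x: "x = k1 \<odot> a + k2 \<odot> b + k3 \<odot> z + k4 \<odot> r"
      using sp unfolding spanned4_iff by blast
    have "a \<star> x = k2 \<odot> z" "b \<star> x = (- k1) \<odot> z"
      by (simp_all add: x br_expand ab br_b_a z_central r')
    then have k: "k1 = 0" "k2 = 0" using yx z0 by simp_all
    have "h x z = 0" "h x r = 0" by (simp_all add: x_def h_co z_central r')
    moreover have "h x z = k4 * h r z" by (simp add: x k h_expand commutator_isotropic)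
    ultimately have "k4 = 0" "h x r = 0" using rz by simp_all
    then show ?thesis using k zr x by (simp add: h_expand x_def[symmetric])
  qed
  then have "h r (a \<star> b) = 0" using h_co[of r a b] by simp
  with rz ab show False by simp
qed

end


text \<open>In dimension three the sign of $h(b,b)$, where $b$ spans the orthogonal complement of $z$ modulo $z$,
cannot be scaled away: this is the origin of the two signatures.\<close>

lemma heisenberg3:
  assumes two_step: "\<And>v x y. v \<star> (x \<star> y) = 0" and ab: "a \<star> b = z" and z0: "z \<noteq> 0"
    and sp: "spanned3 a b z"
  obtains e1 e2 e3 \<epsilon> where "\<epsilon> = 1 \<or> \<epsilon> = - 1" "spanned3 e1 e2 e3"
    "h e1 e1 = 0" "h e1 e2 = 0" "h e1 e3 = of_real \<epsilon>" "h e2 e2 = of_real \<epsilon>" "h e2 e3 = 0" "h e3 e3 = 0"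
    "e1 \<star> e2 = (- \<i>) \<odot> e3" "e1 \<star> e3 = 0" "e2 \<star> e3 = 0"
proof -
  note zz = commutator_isotropic[OF two_step ab z0] and zc = z_central[OF two_step ab z0]
  have "h z a \<noteq> 0 \<or> h z b \<noteq> 0" using nondegenerate3[OF sp, of z] zz z0 by blast
  then have "h a z \<noteq> 0 \<or> h b z \<noteq> 0" using h_zero_sym by blast
  then obtain a1 b1 where a1: "h a1 z \<noteq> 0" "h b1 z = 0" "a1 \<star> b1 = z"
      "a \<in> span {a1, b1}" "b \<in> span {a1, b1}"
    by (rule adapted_pair[OF ab])
  have sp1: "spanned3 a1 b1 z"
    unfolding spanned3_def
  proof (rule span_UNIV_mono)
    show "span {a, b, z} = UNIV" using sp unfolding spanned3_def .
    have "span {a1, b1} \<subseteq> span {a1, b1, z}" by (rule span_mono) auto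
    then show "{a, b, z} \<subseteq> span {a1, b1, z}" using a1(4,5) by (auto intro: span_base)
  qed
  have za1: "h z a1 \<noteq> 0" using a1 h_zero_sym by blast
  have zb1: "h z b1 = 0" using a1 h_zero_sym by blast
  have bb: "h b1 b1 \<noteq> 0"
  proof
    assume b0: "h b1 b1 = 0"
    have "b1 - (h b1 a1 / h z a1) \<odot> z = 0"
      by (rule nondegenerate3[OF sp1]) (use za1 zb1 b0 a1 zz in \<open>simp_all add: h_expand\<close>)
    then have "b1 = (h b1 a1 / h z a1) \<odot> z" by simp
    then have "a1 \<star> b1 = 0" using zc by (metis br_scale_right scale_zero_right)
    with a1 z0 show False by simp
  qed
  define c where "c = h a1 b1 / h b1 b1"
  define a2 where "a2 = a1 - c \<odot> b1"
  have a2: "h a2 z = h a1 z" "a2 \<star> b1 = z" "h a2 b1 = 0"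
    using a1 bb by (simp_all add: a2_def c_def h_expand br_expand)
  obtain k where k: "h (a2 + k \<odot> z) (a2 + k \<odot> z) = 0"
    using isotropic_shift[of z a2] zz a1 a2 by auto
  define a3 where "a3 = a2 + k \<odot> z"
  define p where "p = h a1 z"
  have a3: "h a3 z = p" "a3 \<star> b1 = z" "h a3 b1 = 0" "h a3 a3 = 0"
    using a1 a2 k zz zc zb1 by (simp_all add: a3_def p_def h_expand br_expand)
  define B where "B = Re (h b1 b1)"
  have hB: "h b1 b1 = of_real B"
    unfolding B_def using h_self_real[of b1] by (simp add: complex_eq_iff)
  have B0: "B \<noteq> 0" using bb hB by auto
  define s where "s = sqrt \<bar>B\<bar>"
  have s: "s > 0" "s * s = \<bar>B\<bar>" using B0 by (simp_all add: s_def)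
  define P where "P = cmod p"
  have p0: "p \<noteq> 0" using a1 by (simp add: p_def)
  have P: "P > 0" "p * cnj p = of_real (P * P)" "cnj p * p = of_real (P * P)"
    using p0 by (simp_all add: P_def complex_norm_square[symmetric] power2_eq_square mult.commute)
  define \<epsilon> :: real where "\<epsilon> = sgn B"
  have eps: "\<epsilon> = 1 \<or> \<epsilon> = -1" "\<epsilon> * \<bar>B\<bar> = B" "\<epsilon> * \<epsilon> = 1"
    using B0 by (auto simp: \<epsilon>_def sgn_if)
  define x where "x = sqrt (s / P)"
  have x: "x > 0" "x * x = s / P" using s P by (simp_all add: x_def)
  define y where "y = - of_real (\<epsilon> / (P * s)) * (\<i> * p)"
  have y0: "y \<noteq> 0" using p0 s P eps by (auto simp: y_def)
  have yy: "y * cnj y = of_real (1 / \<bar>B\<bar>)"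
  proof -
    have "y * cnj y = of_real ((\<epsilon> * \<epsilon>) / ((P * P) * (s * s))) * (p * cnj p)"
      by (simp add: y_def algebra_simps)
    also have "\<dots> = of_real ((\<epsilon> * \<epsilon>) / ((P * P) * (s * s)) * (P * P))" unfolding P(2) by simp
    also have "(\<epsilon> * \<epsilon>) / ((P * P) * (s * s)) * (P * P) = 1 / \<bar>B\<bar>"
      unfolding eps(3) s(2) using P(1) by simp
    finally show ?thesis .
  qed
  \<comment> \<open>\<open>y\<close> is fixed by $|y|^2 h(b_1,b_1) = \epsilon$ and a phase that makes $h(e_1,e_3)$ real; \<open>x\<close> then fixes its modulus.\<close>
  define e1 where "e1 = of_real x \<odot> a3"
  define e2 where "e2 = y \<odot> b1"
  define e3 where "e3 = (\<i> * x * y) \<odot> z"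
  have 13: "h e1 e3 = \<epsilon>"
  proof -
    have "h e1 e3 = of_real (x * x) * of_real (\<epsilon> / (P * s)) * (cnj p * p)"
      by (simp add: e1_def e3_def h_expand a3 y_def algebra_simps)
    also have "\<dots> = of_real (x * x * (\<epsilon> / (P * s)) * (P * P))" unfolding P(3) by simp
    also have "x * x * (\<epsilon> / (P * s)) * (P * P) = \<epsilon>"
      unfolding x(2) using s(1) P(1) by simp
    finally show ?thesis .
  qed
  have 22: "h e2 e2 = \<epsilon>"
  proof -
    have "h e2 e2 = (y * cnj y) * h b1 b1" by (simp add: e2_def h_expand)
    also have "\<dots> = of_real (B / \<bar>B\<bar>)" unfolding yy hB by simp
    also have "B / \<bar>B\<bar> = \<epsilon>" using eps(2) B0 by (simp add: field_simps)
    finally show ?thesis .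
  qed
  have sp3: "spanned3 e1 e2 e3"
    unfolding spanned3_def
  proof (rule span_UNIV_mono)
    show "span {a1, b1, z} = UNIV" using sp1 unfolding spanned3_def .
    have "z = (1 / (\<i> * x * y)) \<odot> e3" using x y0 by (simp add: e3_def)
    then have z: "z \<in> span {e1, e2, e3}" by (metis insertCI span_base span_scale)
    have "b1 = (1 / y) \<odot> e2" using y0 by (simp add: e2_def)
    then have b: "b1 \<in> span {e1, e2, e3}" by (metis insertCI span_base span_scale)
    have "a3 = (1 / of_real x) \<odot> e1" using x by (simp add: e1_def)
    then have a: "a3 \<in> span {e1, e2, e3}" by (metis insertCI span_base span_scale)
    have "a1 = a3 - k \<odot> z + c \<odot> b1" by (simp add: a3_def a2_def)
    then have "a1 \<in> span {e1, e2, e3}" using a b z by (metis span_add span_diff span_scale)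
    then show "{a1, b1, z} \<subseteq> span {e1, e2, e3}" using b z by simp
  qed
  show ?thesis
  proof (rule that[of \<epsilon> e1 e2 e3, OF eps(1) sp3])
    show "e1 \<star> e2 = (- \<i>) \<odot> e3"
      by (simp add: e1_def e2_def e3_def br_expand a3 algebra_simps)
  qed (use 13 22 a1(2) zz a3 zc in \<open>simp_all add: e1_def e2_def e3_def h_expand br_expand\<close>)
qed

text \<open>The centre is spanned by $z$ and $r$. It is totally isotropic: $h(z,z)$ and $h(r,z)$ vanish by
compatibility, and $h(r,r)$ because $r$ would otherwise split off. Hence $a$ and $b$ can be corrected to
span a complementary Lagrangian subspace, and the remaining scalar is absorbed by rescaling.\<close>

lemma heisenberg4:
  assumes two_step: "\<And>v x y. v \<star> (x \<star> y) = 0" and ab: "a \<star> b = z" and z0: "z \<noteq> 0"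
    and nsp: "\<not> spanned3 a b z"
  obtains e1 e2 e3 e4 where "spanned4 e1 e2 e3 e4"
    "h e1 e1 = 0" "h e1 e2 = 0" "h e1 e3 = 1" "h e1 e4 = 0" "h e2 e2 = 0" "h e2 e3 = 0"
    "h e2 e4 = 1" "h e3 e3 = 0" "h e3 e4 = 0" "h e4 e4 = 0"
    "e1 \<star> e2 = 0" "e1 \<star> e3 = 0" "e1 \<star> e4 = (- \<i>) \<odot> e3" "e2 \<star> e3 = 0" "e2 \<star> e4 = 0" "e3 \<star> e4 = 0"
proof -
  note zz = commutator_isotropic[OF two_step ab z0] and zc = z_central[OF two_step ab z0]
  obtain r0 where r0: "spanned4 a b z r0" "\<And>x. r0 \<star> x = 0" "\<And>k. r0 \<noteq> k \<odot> z"
    using central_complement[OF two_step ab z0 nsp] by blast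
  have rz: "h r0 z = 0" by (rule central_orthogonal_commutator[OF two_step ab z0 r0(1,2)])
  have rr: "h r0 r0 = 0"
  proof (rule ccontr)
    assume n: "h r0 r0 \<noteq> 0"
    have "h r0 (x \<star> y) = 0" for x y
      using br_multiple[OF two_step ab z0, of x y] rz by (auto simp: h_expand)
    then obtain k where "a = k \<odot> r0" using no_summand[OF n r0(2)] by blast
    then have "a \<star> b = 0" using r0(2) by (simp add: br_expand)
    with ab z0 show False by simp
  qed
  have zr: "h z r0 = 0" using rz h_zero_sym by blast
  have "h z a \<noteq> 0 \<or> h z b \<noteq> 0" using nondegenerate4[OF r0(1), of z] zz z0 zr by blast
  then have "h a z \<noteq> 0 \<or> h b z \<noteq> 0" using h_zero_sym by blast
  then obtain a1 b1 where a1: "h a1 z \<noteq> 0" "h b1 z = 0" "a1 \<star> b1 = z"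
      "a \<in> span {a1, b1}" "b \<in> span {a1, b1}"
    by (rule adapted_pair[OF ab])
  have sp1: "spanned4 a1 b1 z r0"
    unfolding spanned4_def
  proof (rule span_UNIV_mono)
    show "span {a, b, z, r0} = UNIV" using r0 unfolding spanned4_def by blast
    have "span {a1, b1} \<subseteq> span {a1, b1, z, r0}" by (rule span_mono) auto
    then show "{a, b, z, r0} \<subseteq> span {a1, b1, z, r0}" using a1(4,5) by (auto intro: span_base)
  qed
  have za1: "h z a1 \<noteq> 0" using a1 h_zero_sym by blast
  have zb1: "h z b1 = 0" using a1 h_zero_sym by blast
  define r1 where "r1 = r0 - (h r0 a1 / h z a1) \<odot> z"
  have r1: "r1 \<star> x = 0" "x \<star> r1 = 0" "h r1 a1 = 0" "h r1 z = 0" "h r1 r1 = 0" "h r1 r0 = 0" for x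
    using r0(2) br_skew[of x r0] zc zz za1 zr rz rr
    by (simp_all add: r1_def br_expand h_expand)
  have "r1 \<noteq> 0" using r0(3) unfolding r1_def by (metis eq_iff_diff_eq_0)
  then have rb: "h r1 b1 \<noteq> 0" using nondegenerate4[OF sp1, of r1] r1 by blast
  define r where "r = (1 / h r1 b1) \<odot> r1"
  have r: "r \<star> x = 0" "x \<star> r = 0" "h r a1 = 0" "h r z = 0" "h r r = 0" "h r b1 = 1" for x
    using r1 rb by (simp_all add: r_def br_expand h_expand)
  have r': "h a1 r = 0" "h z r = 0" "h b1 r = 1"
    using r h_sym[of r a1] h_sym[of r z] h_sym[of r b1] by simp_all
  obtain k where k: "h (b1 + k \<odot> r) (b1 + k \<odot> r) = 0"
    using isotropic_shift[of r b1] r r' by auto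
  define b2 where "b2 = b1 + k \<odot> r"
  have b2: "h b2 b2 = 0" "h b2 z = 0" "h z b2 = 0" "h b2 r = 1" "h r b2 = 1" "x \<star> b2 = x \<star> b1" for x
    using k a1 zb1 r r' by (simp_all add: b2_def h_expand br_expand)
  define a2 where "a2 = a1 - (h a1 b2) \<odot> r"
  have a2: "h a2 b2 = 0" "h a2 z = h a1 z" "h a2 r = 0" "h r a2 = 0" "a2 \<star> b2 = z"
    using a1 b2 r r' by (simp_all add: a2_def h_expand br_expand)
  obtain l where l: "h (a2 + l \<odot> z) (a2 + l \<odot> z) = 0"
    using isotropic_shift[of z a2] zz a1 a2 by auto
  define p where "p = h a1 z"
  have p0: "p \<noteq> 0" using a1 by (simp add: p_def)
  define e1 where "e1 = a2 + l \<odot> z"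
  have e1: "h e1 e1 = 0" "h e1 b2 = 0" "h e1 z = p" "h e1 r = 0" "h r e1 = 0" "e1 \<star> b2 = z"
    using l a2 b2 r r' zz zc by (simp_all add: e1_def p_def h_expand br_expand)
  define y where "y = - \<i> / cnj p"
  have y: "cnj y = \<i> / p" "y \<noteq> 0" using p0 by (simp_all add: y_def)
  define e2 where "e2 = (1 / cnj y) \<odot> r"
  define e3 where "e3 = (\<i> * y) \<odot> z"
  define e4 where "e4 = y \<odot> b2"
  note d = e2_def e3_def e4_def h_expand br_expand
  have 13: "h e1 e3 = 1" using e1(3) p0 by (simp add: e3_def h_scale_right y(1))
  have 24: "h e2 e4 = 1" using b2(5) y(2) by (simp add: e2_def e4_def h_scale_left h_scale_right)
  have tab: "h e1 e1 = 0" "h e1 e2 = 0" "h e1 e3 = 1" "h e1 e4 = 0" "h e2 e2 = 0" "h e2 e3 = 0"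
    "h e2 e4 = 1" "h e3 e3 = 0" "h e3 e4 = 0" "h e4 e4 = 0"
    using 13 24 by (simp_all add: d e1 r r' b2 zz)
  have "spanned4 e1 e2 e3 e4" by (rule hyperbolic_basis) (rule tab)+
  then show ?thesis
    by (rule that) (use tab in \<open>simp_all add: d e1 zc r\<close>)
qed


section \<open>Products of higher nilpotency class\<close>

text \<open>With $y = p \star q$ not central but $x \star y$ always central, the vectors $x_0 \star y$, $y$, $p$, $q$ are
independent, so they form a basis and the centre is a line. Thus $- \star y$ maps $p$ and $q$ to multiples of one
central vector, and a combination of $p$ and $q$ commutes with $y$: the product is the filiform one.\<close>

lemma filiform_basis:
  assumes w0: "x0 \<star> (p \<star> q) \<noteq> 0" and cen: "\<And>v x. v \<star> (x \<star> (p \<star> q)) = 0"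
  obtains e f2 f3 f4 where "spanned4 e f2 f3 f4" "e \<star> f2 = f3" "e \<star> f3 = f4" "f2 \<star> f3 = 0"
    "\<And>x. x \<star> f4 = 0" "f4 \<noteq> 0"
proof -
  define y where "y = p \<star> q"
  define w where "w = x0 \<star> y"
  have w: "w \<noteq> 0" "x \<star> w = 0" "w \<star> x = 0" for x
    using w0 cen br_skew[of w x] by (auto simp: w_def y_def)
  have vxy: "v \<star> (x \<star> y) = 0" "v \<star> (y \<star> x) = 0" for v x
    using cen br_skew[of y x] by (auto simp: y_def br_minus)
  have pq: "p \<star> q = y" "q \<star> p = - y" by (simp_all add: y_def br_skew[of q p])
  have coeff: "k2 = 0 \<and> k3 = 0 \<and> k4 = 0" if c: "\<And>x. x \<star> (k1 \<odot> w + k2 \<odot> y + k3 \<odot> p + k4 \<odot> q) = 0"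
    for k1 k2 k3 k4
  proof -
    have "x0 \<star> (q \<star> (k1 \<odot> w + k2 \<odot> y + k3 \<odot> p + k4 \<odot> q)) = (- k3) \<odot> w"
      "x0 \<star> (p \<star> (k1 \<odot> w + k2 \<odot> y + k3 \<odot> p + k4 \<odot> q)) = k4 \<odot> w"
      by (simp_all add: br_expand w vxy pq w_def[symmetric])
    then have k: "k3 = 0" "k4 = 0" using c w(1) by simp_all
    have "x0 \<star> (k1 \<odot> w + k2 \<odot> y + k3 \<odot> p + k4 \<odot> q) = k2 \<odot> w"
      by (simp add: k br_expand w w_def[symmetric])
    then show ?thesis using c w(1) k by simp
  qed
  have "indep4 w y p q"
    unfolding indep4_def
  proof (intro allI impI)
    fix k1 k2 k3 k4 assume e: "k1 \<odot> w + k2 \<odot> y + k3 \<odot> p + k4 \<odot> q = 0"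
    have k: "k2 = 0 \<and> k3 = 0 \<and> k4 = 0" by (rule coeff[of k1]) (simp add: e)
    then show "k1 = 0 \<and> k2 = 0 \<and> k3 = 0 \<and> k4 = 0" using e w(1) by simp
  qed
  then have sp: "spanned4 w y p q" by (rule dim_le_4)
  have central: "\<exists>k. c = k \<odot> w" if "\<And>x. x \<star> c = 0" for c
  proof -
    obtain k1 k2 k3 k4 where c: "c = k1 \<odot> w + k2 \<odot> y + k3 \<odot> p + k4 \<odot> q"
      using sp unfolding spanned4_iff by blast
    with coeff[of k1 k2 k3 k4] that have "c = k1 \<odot> w" by simp
    then show ?thesis ..
  qed
  obtain \<alpha> where \<alpha>: "p \<star> y = \<alpha> \<odot> w" using central vxy by blast
  obtain \<beta> where \<beta>: "q \<star> y = \<beta> \<odot> w" using central vxy by blast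
  note outer = that
  \<comment> \<open>The pair $(p,q)$ may be replaced by $(q,-p)$, so one of the two coefficients can be chosen nonzero.\<close>
  have result: thesis if pq: "p \<star> q = y" and \<alpha>: "p \<star> y = \<alpha> \<odot> w" and \<beta>: "q \<star> y = \<beta> \<odot> w"
    and sp: "span {w, y, p, q} = UNIV" and a0: "\<alpha> \<noteq> 0" for p q \<alpha> \<beta>
  proof (rule outer)
    let ?f = "q - (\<beta> / \<alpha>) \<odot> p"
    let ?S = "{p, ?f, y, \<alpha> \<odot> w}"
    show "spanned4 p ?f y (\<alpha> \<odot> w)"
      unfolding spanned4_def
    proof (rule span_UNIV_mono[OF sp])
      have b: "p \<in> span ?S" "?f \<in> span ?S" "y \<in> span ?S" "\<alpha> \<odot> w \<in> span ?S"
        by (rule span_base; simp)+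
      have "q \<in> span ?S" using span_add[OF b(2) span_scale[OF b(1), of "\<beta> / \<alpha>"]] by simp
      moreover have "w \<in> span ?S" using span_scale[OF b(4), of "1 / \<alpha>"] a0 by simp
      ultimately show "{w, y, p, q} \<subseteq> span ?S" using b by simp
    qed
  qed (use pq \<alpha> \<beta> w a0 in \<open>simp_all add: br_expand\<close>)
  show thesis
  proof (cases "\<alpha> = 0")
    case False
    show thesis
      by (rule result[OF pq(1) \<alpha> \<beta> _ False]) (use sp in \<open>simp add: spanned4_def\<close>)
  next
    case True
    obtain k1 k2 k3 k4 where x0: "x0 = k1 \<odot> w + k2 \<odot> y + k3 \<odot> p + k4 \<odot> q"
      using sp unfolding spanned4_iff by blast
    have "x0 \<star> y = (k3 * \<alpha> + k4 * \<beta>) \<odot> w"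
      by (simp add: x0 br_expand w \<alpha> \<beta> scale_left_distrib)
    then have "w = (k4 * \<beta>) \<odot> w" unfolding w_def[symmetric] True by simp
    with w(1) have b0: "\<beta> \<noteq> 0" by (metis mult_zero_right scale_zero_left)
    have "span {w, y, q, - p} = UNIV"
    proof (rule span_UNIV_mono)
      show "span {w, y, p, q} = UNIV" using sp by (simp add: spanned4_def)
      have "- p \<in> span {w, y, q, - p}" by (rule span_base) simp
      then have "p \<in> span {w, y, q, - p}" using span_neg by fastforce
      then show "{w, y, p, q} \<subseteq> span {w, y, q, - p}" by (auto intro: span_base)
    qed
    then show thesis
      by (intro result[of q "- p" \<beta> "- \<alpha>"]) (use pq \<alpha> \<beta> b0 in \<open>simp_all add: br_minus\<close>)
  qed
qed

context
  fixes e f2 f3 f4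
  assumes sp: "spanned4 e f2 f3 f4" and e2: "e \<star> f2 = f3" and e3: "e \<star> f3 = f4"
    and f23: "f2 \<star> f3 = 0" and f4c: "\<And>x. x \<star> f4 = 0" and f4n: "f4 \<noteq> 0"
begin

lemma filiform_table:
  "f2 \<star> e = - f3" "f3 \<star> e = - f4" "f3 \<star> f2 = 0" "f4 \<star> x = 0"
  using e2 e3 f23 f4c br_skew[of f2 e] br_skew[of f3 e] br_skew[of f3 f2] br_skew[of f4 x] by simp_all

lemmas ftab = e2 e3 f23 f4c filiform_table

text \<open>The span of \<open>f2\<close>, \<open>f3\<close>, \<open>f4\<close> is an abelian ideal of codimension one, the
kernel of $h(-,t)$. Products with a vector of the ideal have adjoints with image in the line of $t$, so in the
compatibility condition they contribute only multiples of $h(t,t)$ and $h(t,-)$.\<close>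

lemma dual_vector:
  obtains t where "h t e = 1" "h t f2 = 0" "h t f3 = 0" "h t f4 = 0"
    "\<And>x v. v \<in> span {f2, f3, f4} \<Longrightarrow> co x v = - h x (e \<star> v) \<odot> t"
proof -
  obtain x where x: "h x f4 \<noteq> 0" using h_nondegenerate f4n h_zero_sym by metis
  define t where "t = (- 1 / h x f4) \<odot> co x f3"
  have t: "h t e = 1" "h t f2 = 0" "h t f3 = 0" "h t f4 = 0"
    using x by (simp_all add: t_def h_expand h_co ftab)
  have "co x v = - h x (e \<star> v) \<odot> t" if "v \<in> span {f2, f3, f4}" for x v
  proof -
    obtain c2 c3 c4 where v: "v = c2 \<odot> f2 + c3 \<odot> f3 + c4 \<odot> f4" using \<open>v \<in> _\<close> span3_iff by auto
    have "co x v - (- h x (e \<star> v)) \<odot> t = 0"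
      by (rule nondegenerate4[OF sp]) (simp_all add: h_expand h_co v br_expand ftab t)
    then show ?thesis by (simp add: eq_neg_iff_add_eq_0)
  qed
  with t that show ?thesis by blast
qed

text \<open>It suffices that the dual vector $t$ is a multiple of \<open>f4\<close>, because $t$ is orthogonal to the ideal.
If $h(t,t) \neq 0$, compatibility inside the ideal makes \<open>f4\<close> isotropic and orthogonal to the ideal, hence a
multiple of the non-isotropic $t$, which is absurd. So $h(t,t) = 0$, that is, $t$ lies in the ideal;
compatibility with arguments $e, a, a, t$ then gives $|h(a, e \star t)|^2 = 0$ for $a$ in the ideal, so $e \star t$ is a multiple of $t$. As
$e \star {-}$ is nilpotent on the ideal, $t$ is killed by $e$, and only multiples of \<open>f4\<close> are.\<close>

lemma f4_orthogonal: "h f4 f2 = 0" "h f4 f3 = 0" "h f4 f4 = 0"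
proof -
  obtain t where t: "h t e = 1" "h t f2 = 0" "h t f3 = 0" "h t f4 = 0"
    and co: "\<And>x v. v \<in> span {f2, f3, f4} \<Longrightarrow> co x v = - h x (e \<star> v) \<odot> t"
    by (rule dual_vector) blast
  have inA: "f2 \<in> span {f2, f3, f4}" "f3 \<in> span {f2, f3, f4}" "f4 \<in> span {f2, f3, f4}"
    by (simp_all add: span_base)
  note cof = inA[THEN co]
  have multiple_t: "x = h x e \<odot> t" if "h x f2 = 0" "h x f3 = 0" "h x f4 = 0" for x
  proof -
    have "x - h x e \<odot> t = 0" by (rule nondegenerate4[OF sp]) (simp_all add: h_expand t that)
    then show ?thesis by simp
  qed
  have tt: "h t t = 0"
  proof (rule ccontr)
    assume n: "h t t \<noteq> 0"
    have 34: "h f3 f4 = 0" using manin[of f2 f4 f4 f2] n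
      by (simp add: cof ftab h_expand h_sym[of f3 f4])
    have 44: "h f4 f4 = 0" using manin[of f3 f4 f4 f3] n
      by (simp add: cof ftab h_expand h_self_real)
    have 43: "h f4 f3 = 0" using 34 h_zero_sym by blast
    have "h t t * (h f3 f3 * h f3 f3 + h f2 f4 * cnj (h f2 f4)) = 0"
      using manin[of f2 f3 f2 f3]
      by (simp add: cof ftab h_expand h_self_real 34 43 algebra_simps)
    then have "h f3 f3 * h f3 f3 + h f2 f4 * cnj (h f2 f4) = 0" using n by simp
    moreover have "h f3 f3 = of_real (Re (h f3 f3))"
      using h_self_real[of f3] by (simp add: complex_eq_iff)
    then have "h f3 f3 * h f3 f3 = of_real ((Re (h f3 f3))\<^sup>2)"
      by (metis of_real_mult power2_eq_square)
    ultimately have "complex_of_real ((Re (h f3 f3))\<^sup>2 + (cmod (h f2 f4))\<^sup>2) = 0"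
      by (simp only: of_real_add complex_norm_square)
    then have "(Re (h f3 f3))\<^sup>2 + (cmod (h f2 f4))\<^sup>2 = 0"
      by (simp only: of_real_eq_0_iff)
    then have 24: "h f2 f4 = 0" by (simp add: sum_power2_eq_zero_iff)
    then have 42: "h f4 f2 = 0" using h_zero_sym by blast
    have f4: "f4 = h f4 e \<odot> t" by (rule multiple_t) (fact 42 43 44)+
    then have "h f4 e \<noteq> 0" using f4n by auto
    moreover have "h f4 f4 = h f4 e * cnj (h f4 e) * h t t" by (subst (1 2) f4) (simp add: h_expand)
    ultimately show False using n 44 by simp
  qed
  obtain k1 k2 k3 k4 where t_eq: "t = k1 \<odot> e + k2 \<odot> f2 + k3 \<odot> f3 + k4 \<odot> f4"
    using sp unfolding spanned4_iff by blast
  have "h t t = cnj k1" by (subst (2) t_eq) (simp add: h_expand t)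
  then have k1: "k1 = 0" using tt by simp
  have tA: "t \<in> span {f2, f3, f4}" unfolding span3_iff using t_eq k1 by auto
  define s where "s = e \<star> t"
  have s: "s = k2 \<odot> f3 + k3 \<odot> f4" by (simp add: s_def t_eq k1 br_expand ftab)
  have ts: "h t s = 0" by (simp add: s h_expand t)
  have sA: "h s a = 0" if a: "a \<in> span {f2, f3, f4}" for a
  proof -
    obtain c2 c3 c4 where a_eq: "a = c2 \<odot> f2 + c3 \<odot> f3 + c4 \<odot> f4" using a span3_iff by auto
    have "a \<star> t = 0" by (simp add: a_eq t_eq k1 br_expand ftab)
    moreover have "h t (co t e) = 0"
      using ts by (simp add: h_sym[of t "co t e"] h_co flip: s_def)
    moreover have "h t (co a e) = cnj (h a s)"
      by (simp add: h_sym[of t "co a e"] h_co flip: s_def)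
    ultimately have "h a s * cnj (h a s) = 0"
      using manin[of e a a t] by (simp add: co[OF a] co[OF tA] h_expand tt flip: s_def)
    then show ?thesis using h_zero_sym by auto
  qed
  define \<kappa> where "\<kappa> = h s e"
  have st: "s = \<kappa> \<odot> t" unfolding \<kappa>_def by (rule multiple_t) (auto intro: sA inA)
  have "e \<star> (e \<star> s) = 0" by (simp add: s br_expand ftab)
  moreover have "e \<star> (e \<star> s) = (\<kappa> * \<kappa> * \<kappa>) \<odot> t"
    by (simp add: st br_expand s_def[symmetric])
  moreover have "t \<noteq> 0" using t by auto
  ultimately have "\<kappa> = 0" by simp
  then have s0: "k2 \<odot> f3 + k3 \<odot> f4 = 0" using s st by simp
  have "e \<star> (k2 \<odot> f3 + k3 \<odot> f4) = k2 \<odot> f4" by (simp add: br_expand ftab)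
  then have k2: "k2 = 0" using s0 f4n by simp
  then have k3: "k3 = 0" using s0 f4n by simp
  have t4: "t = k4 \<odot> f4" using t_eq k1 k2 k3 by simp
  then have "k4 \<noteq> 0" using \<open>t \<noteq> 0\<close> by auto
  then show "h f4 f2 = 0" "h f4 f3 = 0" "h f4 f4 = 0" using t unfolding t4 by (simp_all add: h_expand)
qed

text \<open>The vectors \<open>co f3 e\<close> and \<open>co f2 e\<close> are orthogonal to all basis vectors except
\<open>f2\<close>, so they are proportional. Compatibility with arguments $e, v, e, v$ equates their squares
to $h(f_4,f_4) = 0$ and $h(f_3,f_3)$, and proportionality makes both vanish.\<close>

lemma f3_isotropic: "h f3 f3 = 0"
proof (rule ccontr)
  assume n: "h f3 f3 \<noteq> 0"
  obtain t where t: "h t e = 1" "h t f2 = 0" "h t f3 = 0" "h t f4 = 0"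
    and co: "\<And>x v. v \<in> span {f2, f3, f4} \<Longrightarrow> co x v = - h x (e \<star> v) \<odot> t"
    by (rule dual_vector) blast
  have inA: "f2 \<in> span {f2, f3, f4}" "f3 \<in> span {f2, f3, f4}" "f4 \<in> span {f2, f3, f4}"
    by (simp_all add: span_base)
  note cof = inA[THEN co]
  note f4o = f4_orthogonal
  have f4o': "h f2 f4 = 0" "h f3 f4 = 0" using f4o h_zero_sym by blast+
  have "f4 - h f4 e \<odot> t = 0"
    by (rule nondegenerate4[OF sp]) (simp_all add: h_expand t f4o)
  then have f4t: "f4 = h f4 e \<odot> t" by simp
  then have q: "h f4 e \<noteq> 0" using f4n by auto
  have t4: "t = (1 / h f4 e) \<odot> f4" using q by (subst f4t) simp
  have tt: "h t t = 0" using t(4) by (subst (2) t4) (simp add: h_expand)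
  have et: "e \<star> t = 0" by (subst t4) (simp add: br_expand ftab)
  have t_ee: "h t (co e e) = 0" "h (co e e) t = 0"
    by (simp_all add: h_co et h_zero_sym[of t "co e e"])
  have 33: "h (co f3 e) (co f3 e) = 0"
    using manin[of e f3 e f3] by (simp add: ftab cof h_expand f4o f4o' tt)
  have 22: "h (co f2 e) (co f2 e) = h f3 f3"
    using manin[of e f2 e f2] by (simp add: ftab cof h_expand tt t_ee)
  have "h f2 f3 \<odot> co f3 e - h f3 f3 \<odot> co f2 e = 0"
    by (rule nondegenerate4[OF sp]) (simp_all add: h_expand h_co ftab f4o')
  then have "h f2 f3 \<odot> co f3 e = h f3 f3 \<odot> co f2 e" by simp
  then have "h (h f2 f3 \<odot> co f3 e) (h f2 f3 \<odot> co f3 e) = h (h f3 f3 \<odot> co f2 e) (h f3 f3 \<odot> co f2 e)"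
    by simp
  then show False using n by (simp add: h_expand 33 22)
qed

text \<open>By the two orthogonality results the span of \<open>f3\<close> and \<open>f4\<close> is Lagrangian, and shifts
along it and along \<open>f2\<close> bring the Gram matrix to antidiagonal form with two free scalars
$p = h(f_2,f_3)$ and $q = h(e,f_4)$. Rescaling $e$ and \<open>f2\<close> by $x$ and $y$ multiplies them by
$|y|^2 \bar x$ and $|x|^2 \bar x \bar y$, and both can be made standard.\<close>

lemma filiform4:
  obtains e1 e2 e3 e4 where "spanned4 e1 e2 e3 e4"
    "h e1 e1 = 0" "h e1 e2 = 0" "h e1 e3 = 1" "h e1 e4 = 0" "h e2 e2 = 0" "h e2 e3 = 0"
    "h e2 e4 = 1" "h e3 e3 = 0" "h e3 e4 = 0" "h e4 e4 = 0"
    "e1 \<star> e2 = \<i> \<odot> e4" "e1 \<star> e3 = 0" "e1 \<star> e4 = (- \<i>) \<odot> e3" "e2 \<star> e3 = 0" "e2 \<star> e4 = 0" "e3 \<star> e4 = 0"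
proof -
  note o = f4_orthogonal f3_isotropic
  have o': "h f2 f4 = 0" "h f3 f4 = 0" using o h_zero_sym by blast+
  have 4: "h f4 e \<noteq> 0" using nondegenerate4[OF sp, of f4] o f4n by blast
  have 3: "h f3 f2 \<noteq> 0"
  proof
    assume z: "h f3 f2 = 0"
    have "f3 - (h f3 e / h f4 e) \<odot> f4 = 0"
      by (rule nondegenerate4[OF sp]) (use 4 in \<open>simp_all add: h_expand o o' z\<close>)
    then have "f3 = (h f3 e / h f4 e) \<odot> f4" by simp
    then have "e \<star> f3 = 0" by (metis br_scale_right f4c scale_zero_right)
    then show False using e3 f4n by simp
  qed
  define p where "p = h f2 f3"
  have p0: "p \<noteq> 0" using 3 h_zero_sym by (auto simp: p_def)
  have hp: "h f3 f2 = cnj p" unfolding p_def by (rule h_sym)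
  define q where "q = h e f4"
  have q0: "q \<noteq> 0" using 4 h_zero_sym by (auto simp: q_def)
  have hq: "h f4 e = cnj q" unfolding q_def by (rule h_sym)
  obtain b where b: "h (f2 + b \<odot> f3) (f2 + b \<odot> f3) = 0"
    using isotropic_shift[of f3 f2] o p0 by (auto simp: p_def)
  define g2 where "g2 = f2 + b \<odot> f3"
  define g3 where "g3 = f3 + b \<odot> f4"
  have g: "h g2 g2 = 0" "h g2 g3 = p" "h g3 g2 = cnj p" "h g2 f4 = 0" "h f4 g2 = 0" "h g3 f4 = 0"
    "h f4 g3 = 0" "h g3 g3 = 0"
    using b by (simp_all add: g2_def g3_def h_expand o o' hp p_def[symmetric])
  have gb: "e \<star> g2 = g3" "e \<star> g3 = f4" "g2 \<star> g3 = 0"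
    by (simp_all add: g2_def g3_def br_expand ftab)
  define d where "d = e - (h e g3 / p) \<odot> g2"
  have d: "h d g3 = 0" "h d f4 = q" "h f4 d = cnj q" "d \<star> g2 = g3" "d \<star> g3 = f4"
    using p0 by (simp_all add: d_def h_expand br_expand g gb q_def hq)
  define d' where "d' = d - (h d g2 / cnj p) \<odot> g3"
  have d': "h d' g3 = 0" "h d' g2 = 0" "h d' f4 = q" "h f4 d' = cnj q" "d' \<star> g2 = g3" "d' \<star> g3 = f4"
    using p0 gb d br_skew[of g3 g2] by (simp_all add: d'_def h_expand br_expand g)
  obtain c where c: "h (d' + c \<odot> f4) (d' + c \<odot> f4) = 0"
    using isotropic_shift[of f4 d'] o d' q0 by auto
  define e' where "e' = d' + c \<odot> f4"
  have e': "h e' e' = 0" "h e' g2 = 0" "h e' g3 = 0" "h e' f4 = q" "e' \<star> g2 = g3" "e' \<star> g3 = f4"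
    using c by (simp_all add: e'_def h_expand br_expand g o d' ftab)
  \<comment> \<open>The modulus of \<open>y\<close> is the solution \<open>B\<close> of $B^5 |p|^3 = |q|$ that the two scaling conditions force.\<close>
  define P where "P = cmod p"
  define Q where "Q = cmod q"
  have P: "P > 0" "p * cnj p = of_real (P * P)" and Q: "Q > 0" "q * cnj q = of_real (Q * Q)"
    using p0 q0 by (simp_all add: P_def Q_def complex_norm_square[symmetric] power2_eq_square)
  define B where "B = root 5 (Q / P ^ 3)"
  have B: "B > 0" "B ^ 5 * P ^ 3 = Q" using P Q by (simp_all add: B_def)
  define x where "x = \<i> / (of_real (B\<^sup>2) * cnj p)"
  define y where "y = - (\<i> * of_real (B ^ 6 * P\<^sup>2) * cnj p / cnj q)"
  have x: "cnj x = - \<i> / (of_real (B\<^sup>2) * p)" by (simp add: x_def)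
  have yy: "y * cnj y = of_real (B\<^sup>2)"
  proof -
    have "y * cnj y = of_real ((B ^ 6 * P\<^sup>2)\<^sup>2) * (p * cnj p) / (q * cnj q)"
      by (simp add: y_def algebra_simps power2_eq_square)
    also have "\<dots> = of_real ((B ^ 6 * P\<^sup>2)\<^sup>2 * (P * P) / (Q * Q))"
      unfolding P(2) Q(2) by simp
    also have "(B ^ 6 * P\<^sup>2)\<^sup>2 * (P * P) / (Q * Q) = B\<^sup>2"
      unfolding B(2)[symmetric] using B(1) P(1) by (simp add: field_simps power_numeral_reduce)
    finally show ?thesis .
  qed
  define e1 where "e1 = x \<odot> e'"
  define u2 where "u2 = y \<odot> g2"
  define u4 where "u4 = (- \<i> * x * y) \<odot> g3"
  define u3 where "u3 = (x * x * y) \<odot> f4"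
  have 24: "h u2 u4 = 1"
  proof -
    have "h u2 u4 = \<i> * (y * cnj y) * (cnj x * p)"
      by (simp add: u2_def u4_def h_expand g)
    also have "\<dots> = 1" unfolding yy x using B(1) p0 by simp
    finally show ?thesis .
  qed
  have 13: "h e1 u3 = 1"
  proof -
    have xx: "x * cnj x = of_real (1 / (B ^ 4 * (P * P)))"
    proof -
      have "x * cnj x = 1 / (of_real (B ^ 4) * (p * cnj p))" unfolding x by (simp add: x_def power2_eq_square power4_eq_xxxx)
      then show ?thesis unfolding P(2) by simp
    qed
    have "h e1 u3 = (x * cnj x) * (cnj x * cnj y * q)"
      by (simp add: e1_def u3_def h_expand e')
    also have "cnj x * cnj y * q = of_real (B ^ 4 * (P * P))"
      unfolding x using p0 q0 B(1) by (simp add: y_def power2_eq_square power_numeral_reduce)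
    also have "x * cnj x * of_real (B ^ 4 * (P * P)) = 1"
      unfolding xx using B(1) P(1) by simp
    finally show ?thesis .
  qed
  note dd = e1_def u2_def u3_def u4_def h_expand br_expand
  have tab: "h e1 e1 = 0" "h e1 u2 = 0" "h e1 u3 = 1" "h e1 u4 = 0" "h u2 u2 = 0" "h u2 u3 = 0"
    "h u2 u4 = 1" "h u3 u3 = 0" "h u3 u4 = 0" "h u4 u4 = 0"
    using 13 24 by (simp_all add: dd e' g o)
  have sp': "spanned4 e1 u2 u3 u4" by (rule hyperbolic_basis) (rule tab)+
  show ?thesis
  proof (rule that[OF sp' tab])
    show "e1 \<star> u2 = \<i> \<odot> u4" "e1 \<star> u4 = (- \<i>) \<odot> u3"
      by (simp_all add: e1_def u2_def u3_def u4_def br_expand e' ac_simps)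
    show "e1 \<star> u3 = 0" "u2 \<star> u3 = 0" "u2 \<star> u4 = 0" "u3 \<star> u4 = 0"
      by (simp_all add: e1_def u2_def u3_def u4_def br_expand gb ftab)
  qed
qed

end

end

section \<open>The complex structure of a pseudo-Hermitian quadratic Lie algebra\<close>

text \<open>
The vector $x$ of the real Lie algebra stands for $x - i J x$ in the $i$-eigenspace of $J$. Under this
identification \<open>cprod\<close> is the bracket of the eigenspace, \<open>cadj A x w\<close> the component in the eigenspace of
the bracket of $x - iJx$ with the conjugate $w + iJw$, and \<open>cherm\<close> the pairing with the conjugate, up to a factor two.
\<close>

definition cscale :: "'a::real_vector phq_algebra \<Rightarrow> complex \<Rightarrow> 'a \<Rightarrow> 'a" where
  "cscale A c x = Re c *\<^sub>R x + Im c *\<^sub>R cstr A x"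

definition cprod :: "'a::real_vector phq_algebra \<Rightarrow> 'a \<Rightarrow> 'a \<Rightarrow> 'a" where
  "cprod A x y = bracket A x y - bracket A (cstr A x) (cstr A y)"

definition cadj :: "'a::real_vector phq_algebra \<Rightarrow> 'a \<Rightarrow> 'a \<Rightarrow> 'a" where
  "cadj A x w = bracket A x w + cstr A (bracket A x (cstr A w))"

definition cherm :: "'a::real_vector phq_algebra \<Rightarrow> 'a \<Rightarrow> 'a \<Rightarrow> complex" where
  "cherm A x y = Complex (metric A x y) (metric A x (cstr A y))"

locale phq =
  fixes A :: "'a::real_vector phq_algebra"
  assumes phq_lie_algebra: "phq_lie_algebra A"
begin

abbreviation "J \<equiv> cstr A"
abbreviation "B \<equiv> bracket A"
abbreviation "g \<equiv> metric A"

lemma bilinear_B: "bilinear B" and bilinear_g: "bilinear g" and linear_J: "linear J"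
  and B_self [simp]: "B x x = 0" and J_J [simp]: "J (J x) = - x"
  and g_sym: "g x y = g y x" and g_nondegenerate: "(\<And>y. g x y = 0) \<Longrightarrow> x = 0"
  and g_J_J [simp]: "g (J x) (J y) = g x y"
  and jacobi: "B x (B y z) + B y (B z x) + B z (B x y) = 0"
  and integrable: "B x y + J (B (J x) y) + J (B x (J y)) - B (J x) (J y) = 0"
  and g_invariant: "g (B x y) z + g y (B x z) = 0"
  using phq_lie_algebra
  by (auto simp: phq_lie_algebra_def lie_bracket_def complex_structure_def)

lemmas B_linear = bilinear_ladd[OF bilinear_B] bilinear_radd[OF bilinear_B]
  bilinear_lmul[OF bilinear_B] bilinear_rmul[OF bilinear_B] bilinear_lneg[OF bilinear_B]
  bilinear_rneg[OF bilinear_B] bilinear_lsub[OF bilinear_B] bilinear_rsub[OF bilinear_B]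
  bilinear_lzero[OF bilinear_B] bilinear_rzero[OF bilinear_B]

lemmas g_linear = bilinear_ladd[OF bilinear_g] bilinear_radd[OF bilinear_g]
  bilinear_lmul[OF bilinear_g] bilinear_rmul[OF bilinear_g] bilinear_lneg[OF bilinear_g]
  bilinear_rneg[OF bilinear_g] bilinear_lsub[OF bilinear_g] bilinear_rsub[OF bilinear_g]
  bilinear_lzero[OF bilinear_g] bilinear_rzero[OF bilinear_g]

lemmas J_linear = linear_add[OF linear_J] linear_cmul[OF linear_J] linear_neg[OF linear_J]
  linear_diff[OF linear_J] linear_0[OF linear_J]

lemma B_skew: "B y x = - B x y"
proof -
  have "B x y + B y x = 0" using B_self[of "x + y", unfolded B_linear(1,2)] by (simp add: add.commute)
  then show ?thesis by (simp add: eq_neg_iff_add_eq_0 add.commute)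
qed

lemma g_J_left: "g (J x) y = - g x (J y)"
  using g_J_J[of x "J y"] by (simp add: g_linear)

lemma g_eqI: "(\<And>z. g x z = g y z) \<Longrightarrow> x = y"
  using g_nondegenerate[of "x - y"] by (simp add: g_linear)

lemma g_B_cyclic: "g (B x y) z = g (B y z) x"
  using g_invariant[of y x z] by (simp add: B_skew[of x y] g_linear g_sym[of x])

lemma B_J_J: "B (J x) (J y) = B x y + J (B (J x) y) + J (B x (J y))"
  using integrable[of x y] by simp

lemma J_B_J_J: "J (B (J x) (J y)) = J (B x y) - B (J x) y - B x (J y)"
  by (simp add: B_J_J J_linear)

lemma cprod_J: "cprod A (J x) y = J (cprod A x y)" "cprod A x (J y) = J (cprod A x y)"
  by (simp_all add: cprod_def J_linear J_B_J_J B_linear)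

lemma cadj_J: "cadj A (J x) w = J (cadj A x w)" "cadj A x (J w) = - J (cadj A x w)"
  by (simp_all add: cadj_def J_linear J_B_J_J B_linear)

lemma J_cprod: "J (cprod A x y) = B (J x) y + B x (J y)"
  by (simp add: cprod_def J_linear J_B_J_J)

lemma g_cadj: "g (cadj A x w) y = g x (cprod A w y)"
  using g_B_cyclic[of w y x] g_B_cyclic[of "J w" "J y" x] g_B_cyclic[of x w y] g_B_cyclic[of x "J w" "J y"]
  by (simp add: cadj_def cprod_def g_linear g_J_left g_sym[of x])

text \<open>The form $g([x,y],z)$ is alternating, and integrability says that it has no component of type $(3,0)$ or
$(0,3)$; hence its components of type $(2,1)$ and $(1,2)$, which \<open>cprod\<close> sees, determine it.\<close>

lemma twice_bracket: "2 * g (B x y) z = g (cprod A x y) z + g (cprod A y z) x + g (cprod A z x) y"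
proof -
  have "g (B (J x) (J y)) z = g (B x y) z - g (B (J z) (J x)) y - g (B (J y) (J z)) x"
    using g_B_cyclic[of "J x" y "J z"] g_B_cyclic[of y "J z" "J x"] g_B_cyclic[of x "J y" "J z"]
    by (simp add: B_J_J[of x y] g_linear g_J_left)
  then show ?thesis
    using g_B_cyclic[of x y z] g_B_cyclic[of y z x] by (simp add: cprod_def g_linear)
qed

lemma twice_bracket_cadj: "2 *\<^sub>R B x y = cprod A x y + cadj A x y - cadj A y x"
proof -
  have "cprod A x y + cadj A x y - cadj A y x =
      B x y + B x y + B x y - B (J x) (J y) + J (B x (J y)) + J (B (J x) y)"
    by (simp add: cprod_def cadj_def B_skew[of y x] B_skew[of y "J x"] J_linear)
  also have "\<dots> = B x y + B x y" by (simp add: B_J_J)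
  finally show ?thesis by (simp add: scaleR_2)
qed

text \<open>Real and imaginary part of the bracket of $x - iJx$ with $y + iJy$ in the complexification.\<close>

definition "mixed_Re x y = B x y + B (J x) (J y)"
definition "mixed_Im x y = B x (J y) - B (J x) y"

lemma twice_cadj: "2 *\<^sub>R cadj A x w = mixed_Re x w + J (mixed_Im x w)"
  by (simp add: mixed_Re_def mixed_Im_def cadj_def B_J_J J_linear scaleR_2)

lemma cadj_pair:
  "2 * (g (cadj A v w) (cadj A y u) + g (cadj A u y) (cadj A w v)) =
     g (mixed_Im v w) (mixed_Im u y) - g (mixed_Re v w) (mixed_Re u y)"
proof -
  have s: "mixed_Re y u = - mixed_Re u y" "mixed_Im y u = mixed_Im u y" "mixed_Re w v = - mixed_Re v w" "mixed_Im w v = mixed_Im v w"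
    by (simp_all add: mixed_Re_def mixed_Im_def B_skew[of y u] B_skew[of w v] B_skew[of "J y" "J u"] B_skew[of "J w" "J v"]
      B_skew[of y "J u"] B_skew[of "J y" u] B_skew[of w "J v"] B_skew[of "J w" v])
  have "4 * (g (cadj A v w) (cadj A y u) + g (cadj A u y) (cadj A w v)) =
      g (2 *\<^sub>R cadj A v w) (2 *\<^sub>R cadj A y u) + g (2 *\<^sub>R cadj A u y) (2 *\<^sub>R cadj A w v)"
    by (simp add: g_linear)
  also have "\<dots> = 2 * (g (mixed_Im v w) (mixed_Im u y) - g (mixed_Re v w) (mixed_Re u y))"
    unfolding twice_cadj s
    by (simp add: g_linear g_J_left g_sym[of "mixed_Re u y"] g_sym[of "mixed_Im u y"])
  finally show ?thesis by simp
qed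

lemma g_jacobi: "g (B u v) (B w y) + g (B v w) (B u y) - g (B u w) (B v y) = 0"
proof -
  have "g (B u v) (B w y) = g (B w (B v u)) y" for u v w
    using g_invariant[of w "B u v" y] B_skew[of v u] by (simp add: B_linear g_linear)
  then have "g (B u v) (B w y) + g (B v w) (B u y) - g (B u w) (B v y)
     = g (B w (B v u) + B u (B w v) + B v (B u w)) y"
    by (simp add: g_linear B_linear B_skew[of w u])
  also have "B w (B v u) + B u (B w v) + B v (B u w) = 0" using jacobi[of w v u] by (simp add: add_ac)
  finally show ?thesis by (simp add: g_linear)
qed

text \<open>The real part of the compatibility condition. It is the sum, with signs, of the eight instances of the
Jacobi identity in which an even number of the four arguments is replaced by its image under $J$: the real part
of the Jacobi identity for the complexified arguments.\<close>

lemma g_manin: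
  "g (cprod A u v) (cprod A w y) =
     g (cadj A v w) (cadj A y u) - g (cadj A u w) (cadj A y v)
     + g (cadj A u y) (cadj A w v) - g (cadj A v y) (cadj A w u)"
proof -
  have "2 * g (cprod A u v) (cprod A w y) =
      g (cprod A u v) (cprod A w y) + g (J (cprod A u v)) (J (cprod A w y))" by simp
  also have "\<dots> = g (B u v - B (J u) (J v)) (B w y - B (J w) (J y))
      + g (B (J u) v + B u (J v)) (B (J w) y + B w (J y))"
    unfolding J_cprod by (simp add: cprod_def)
  also have "\<dots> = (g (mixed_Im v w) (mixed_Im u y) - g (mixed_Re v w) (mixed_Re u y)) - (g (mixed_Im u w) (mixed_Im v y) - g (mixed_Re u w) (mixed_Re v y))"
    using g_jacobi[of u v w y] g_jacobi[of "J u" "J v" w y] g_jacobi[of u v "J w" "J y"]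
      g_jacobi[of "J u" v "J w" y] g_jacobi[of "J u" v w "J y"] g_jacobi[of u "J v" "J w" y]
      g_jacobi[of u "J v" w "J y"] g_jacobi[of "J u" "J v" "J w" "J y"]
    unfolding mixed_Re_def mixed_Im_def g_linear by linarith
  finally show ?thesis using cadj_pair[of v w y u] cadj_pair[of u w y v] by simp
qed

lemma hermitian_lie: "hermitian_lie (cscale A) (cprod A) (cadj A) (cherm A)"
proof unfold_locales
  fix x y z u v w :: 'a and a b c :: complex
  show "cscale A a (x + y) = cscale A a x + cscale A a y"
    by (simp add: cscale_def J_linear algebra_simps)
  show "cscale A (a + b) x = cscale A a x + cscale A b x"
    by (simp add: cscale_def algebra_simps)
  show "cscale A a (cscale A b x) = cscale A (a * b) x"
    by (simp add: cscale_def J_linear algebra_simps)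
  show "cscale A 1 x = x" by (simp add: cscale_def)
  show "cprod A (x + y) z = cprod A x z + cprod A y z"
    by (simp add: cprod_def B_linear J_linear)
  have *: "cprod A (r *\<^sub>R x) y = r *\<^sub>R cprod A x y" for r x
    by (simp add: cprod_def B_linear J_linear algebra_simps)
  have "cprod A (x + z) y = cprod A x y + cprod A z y" for x z
    by (simp add: cprod_def B_linear J_linear)
  then show "cprod A (cscale A c x) y = cscale A c (cprod A x y)"
    unfolding cscale_def by (simp add: * cprod_J)
  show "cprod A y x = - cprod A x y"
    by (simp add: cprod_def B_skew[of y x] B_skew[of "J y" "J x"])
  show "cprod A x x = 0" by (simp add: cprod_def)
  show "cherm A (x + y) z = cherm A x z + cherm A y z"
    by (simp add: cherm_def complex_eq_iff g_linear)
  show "cherm A (cscale A c x) y = c * cherm A x y"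
    by (simp add: cherm_def cscale_def complex_eq_iff g_linear g_J_left algebra_simps)
  show "cherm A y x = cnj (cherm A x y)"
    by (simp add: cherm_def complex_eq_iff g_sym[of y x] g_sym[of y "J x"] g_J_left)
  show "cherm A (cadj A x w) y = cherm A x (cprod A w y)"
    by (simp add: cherm_def complex_eq_iff g_cadj cprod_J flip: cprod_J(2))
  show "cherm A (cprod A u v) (cprod A w y) =
       cherm A (cadj A v w) (cadj A y u) - cherm A (cadj A u w) (cadj A y v)
       + cherm A (cadj A u y) (cadj A w v) - cherm A (cadj A v y) (cadj A w u)"
    \<comment> \<open>Both sides are complex linear in \<open>u\<close>, so the imaginary part is the real part at \<open>J u\<close>.\<close>
    using g_manin[of u v w y] g_manin[of "J u" v w y]
    by (simp add: cherm_def complex_eq_iff cprod_J cadj_J g_J_left g_linear)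
next
  fix x assume "\<And>y. cherm A x y = 0"
  then show "x = 0" by (intro g_nondegenerate) (simp add: cherm_def complex_eq_iff)
qed

sublocale C: hermitian_lie "cscale A" "cprod A" "cadj A" "cherm A"
  by (rule hermitian_lie)

lemma J_eq_cscale: "J x = cscale A \<i> x"
  by (simp add: cscale_def)

lemma cscale_of_real: "cscale A (of_real r) x = r *\<^sub>R x"
  by (simp add: cscale_def)

lemma cscale_scaleR: "cscale A c (r *\<^sub>R x) = cscale A (r *\<^sub>R c) x" "r *\<^sub>R cscale A c x = cscale A (r *\<^sub>R c) x"
  by (simp_all add: cscale_def J_linear algebra_simps)

lemma Re_cherm: "g x y = Re (cherm A x y)"
  by (simp add: cherm_def)

text \<open>The complex lower central series is contained in the largest $J$-stable part of the real one, because both the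
product and its image under $J$ are sums of brackets.\<close>

lemma left_normed_subset: "x \<in> C.left_normed k \<Longrightarrow> x \<in> lower_central A k \<and> J x \<in> lower_central A k"
proof (induction k arbitrary: x)
  case 0
  then show ?case by simp
next
  case (Suc k)
  then obtain u v where x: "x = cprod A u v" and "v \<in> C.left_normed k" by auto
  then have v: "v \<in> lower_central A k" "J v \<in> lower_central A k" using Suc.IH by auto
  let ?S = "{B x y | x y. y \<in> lower_central A k}"
  have "B u v \<in> span ?S" "B (J u) (J v) \<in> span ?S" "B (J u) v \<in> span ?S" "B u (J v) \<in> span ?S"
    using v by (auto intro!: real_vector.span_base)
  then show ?case
    unfolding x J_cprod by (simp add: cprod_def real_vector.span_diff real_vector.span_add)
qed

lemma left_normed_nilpotent:
  assumes "nilpotent A"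
  obtains k where "C.left_normed k \<subseteq> {0}"
proof -
  obtain k where k: "lower_central A k = {0}" using assms by (auto simp: nilpotent_def)
  have "C.left_normed k \<subseteq> {0}" using left_normed_subset k by blast
  then show ?thesis by (rule that)
qed

end

section \<open>Transfer between real and complex data\<close>

context phq
begin

text \<open>The bracket need not be compared: by \<open>twice_bracket\<close> it is determined by the complex product and the metric.\<close>

lemma phq_equivalentI:
  fixes M :: "'b::real_vector phq_algebra" and f :: "'b \<Rightarrow> 'a"
  assumes M: "phq_lie_algebra M" and lin: "linear f" and surj: "surj f"
    and fJ: "\<And>u. f (cstr M u) = J (f u)"
    and fg: "\<And>u v. g (f u) (f v) = metric M u v"
    and fp: "\<And>u v. f (cprod M u v) = cprod A (f u) (f v)"
  shows "phq_equivalent A M"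
proof -
  interpret M: phq M by unfold_locales (rule M)
  have "inj f"
  proof (rule injI)
    fix u v assume "f u = f v"
    then have "metric M u w = metric M v w" for w by (metis fg)
    then show "u = v" by (rule M.g_eqI)
  qed
  with surj have bij: "bij f" by (simp add: bij_def)
  have fB: "f (bracket M u v) = B (f u) (f v)" for u v
  proof (rule g_eqI)
    fix z
    obtain w where z: "z = f w" using surj by (metis surjD)
    have "2 * g (f (bracket M u v)) z = 2 * g (B (f u) (f v)) z"
      unfolding z fg M.twice_bracket twice_bracket by (simp add: fg flip: fp)
    then show "g (f (bracket M u v)) z = g (B (f u) (f v)) z" by simp
  qed
  have inv: "inv f (f u) = u" "f (inv f x) = x" for u x
    using bij by (simp_all add: bij_is_inj bij_is_surj surj_f_inv_f)
  have "linear (inv f)"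
    by (rule linearI) (metis inv linear_add[OF lin], metis inv linear_cmul[OF lin])
  moreover have "inv f (B x y) = bracket M (inv f x) (inv f y)" for x y by (metis fB inv)
  moreover have "cstr M (inv f x) = inv f (J x)" for x by (metis fJ inv)
  moreover have "metric M (inv f x) (inv f y) = g x y" for x y by (metis fg inv)
  ultimately show ?thesis
    unfolding phq_equivalent_def using bij_imp_bij_inv[OF bij] by blast
qed

text \<open>Five complex independent vectors would give an injective real linear map from a space of real dimension ten.\<close>

lemma spanned4_if_indep4:
  assumes S: "finite S" "span S = (UNIV :: 'a set)" and dim: "dim (UNIV :: 'a set) \<le> 8"
    and ind: "C.indep4 a b c d"
  shows "C.spanned4 a b c d"
proof (rule ccontr)
  assume "\<not> C.spanned4 a b c d"
  then obtain x where x: "\<And>k1 k2 k3 k4. x \<noteq> cscale A k1 a + cscale A k2 b + cscale A k3 c + cscale A k4 d"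
    unfolding C.spanned4_iff by blast
  define F :: "complex \<times> complex \<times> complex \<times> complex \<times> complex \<Rightarrow> 'a" where
    "F = (\<lambda>(k1, k2, k3, k4, k5).
      cscale A k1 a + cscale A k2 b + cscale A k3 c + cscale A k4 d + cscale A k5 x)"
  have lin: "linear F"
    by (rule linearI) (auto simp: F_def cscale_def algebra_simps)
  have "inj F"
  proof (subst linear_injective_0[OF lin], intro allI impI)
    fix k assume "F k = 0"
    then obtain k1 k2 k3 k4 k5 where k: "k = (k1, k2, k3, k4, k5)"
      and e: "cscale A k1 a + cscale A k2 b + cscale A k3 c + cscale A k4 d + cscale A k5 x = 0"
      by (cases k) (auto simp: F_def)
    have k5: "k5 = 0"
    proof (rule ccontr)
      assume n: "k5 \<noteq> 0"
      then have "x = cscale A (1 / k5) (cscale A k5 x)" by simp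
      also have "cscale A k5 x = - (cscale A k1 a + cscale A k2 b + cscale A k3 c + cscale A k4 d)"
        using e by (metis add_eq_0_iff)
      also have "cscale A (1 / k5) \<dots> = cscale A (- k1 / k5) a + cscale A (- k2 / k5) b
          + cscale A (- k3 / k5) c + cscale A (- k4 / k5) d"
        by (simp add: C.scale_right_distrib C.scale_right_diff_distrib)
      finally show False using x by blast
    qed
    then show "k = 0" using e ind k unfolding C.indep4_def by (simp add: zero_prod_def)
  qed
  have "independent (F ` Basis)"
    by (rule linear_independent_injective_image[OF lin independent_Basis])
       (use \<open>inj F\<close> in \<open>auto intro: inj_on_subset\<close>)
  moreover obtain T where T: "independent T" "span T = (UNIV :: 'a set)" "card T = dim (UNIV :: 'a set)"
    using real_vector.basis_exists[of "UNIV :: 'a set"] by (metis top.extremum_uniqueI)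
  moreover have "finite T"
    using real_vector.independent_span_bound[OF S(1) T(1)] S(2) by simp
  ultimately have "card (F ` Basis) \<le> dim (UNIV :: 'a set)"
    using real_vector.independent_span_bound[of T "F ` Basis"] by simp
  moreover have "card (F ` Basis) = 10"
    using \<open>inj F\<close> by (subst card_image) (auto intro: inj_on_subset)
  ultimately show False using dim by simp
qed

text \<open>Both adjoints in the expression of the bracket through complex data vanish on $r$, so the complex line of
$r$ is central in the real Lie algebra. A central line on which the metric is nondegenerate splits off together with
its orthogonal complement.\<close>

lemma no_orthogonal_summand:
  assumes ind: "indecomposable A" and rr: "cherm A r r \<noteq> 0"
    and central: "\<And>x. cprod A r x = 0" and orth: "\<And>x y. cherm A r (cprod A x y) = 0"
  shows "\<exists>k. x = cscale A k r"
proof -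
  define I where "I = range (\<lambda>k. cscale A k r)"
  define K where "K = {x. cherm A x r = 0}"
  have "cadj A r x = 0" for x by (rule C.co_eq_0I) (rule orth)
  moreover have "cadj A x r = 0" for x by (rule C.co_eq_0I) (simp add: central)
  ultimately have Br: "B r x = 0" for x using twice_bracket_cadj[of r x] central by simp
  have BJr: "B (J r) x = 0" for x
    using central[of "J x"] Br by (simp add: cprod_def B_linear)
  have BI: "B x y = 0" if "y \<in> I" for x y
    using that Br BJr B_skew[of x y] by (auto simp: I_def cscale_def B_linear)
  have r0: "r \<noteq> 0" using rr by auto
  have gI: "g x y = 0" if "y \<in> I" "x \<in> K" for x y
    using that by (auto simp: I_def K_def Re_cherm C.h_scale_right)
  have sI: "real_vector.subspace I"
  proof (rule real_vector.subspaceI)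
    show "0 \<in> I" by (auto simp: I_def image_iff intro: exI[of _ 0])
    show "x + y \<in> I" if "x \<in> I" "y \<in> I" for x y
      using that by (auto simp: I_def simp flip: C.scale_left_distrib)
    show "c *\<^sub>R x \<in> I" if "x \<in> I" for c x
      using that by (auto simp: I_def cscale_scaleR)
  qed
  have split: "cscale A (cherm A x r / cherm A r r) r \<in> I" "x - cscale A (cherm A x r / cherm A r r) r \<in> K" for x
    using rr by (auto simp: I_def K_def C.h_expand)
  have Iid: "phq_ideal A I"
    unfolding phq_ideal_def
  proof (intro conjI allI ballI impI)
    show "real_vector.subspace I" by (rule sI)
    show "B x y \<in> I" if "y \<in> I" for x y
      using BI[OF that] real_vector.subspace_0[OF sI] by simp
    show "J x \<in> I" if "x \<in> I" for x using that by (auto simp: I_def J_eq_cscale)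
    fix x assume x: "x \<in> I" "\<forall>y\<in>I. g x y = 0"
    show "x = 0"
    proof (rule g_nondegenerate)
      fix y
      have "g x y = g x (cscale A (cherm A y r / cherm A r r) r) + g x (y - cscale A (cherm A y r / cherm A r r) r)"
        by (simp flip: g_linear)
      then show "g x y = 0" using x(2) split gI[OF x(1) split(2), of y] g_sym by simp
    qed
  qed
  have Kid: "phq_ideal A K"
    unfolding phq_ideal_def
  proof (intro conjI allI ballI impI)
    show "real_vector.subspace K"
      by (rule real_vector.subspaceI)
         (auto simp: K_def C.h_add_left C.h_scale_left simp flip: cscale_of_real)
    show "J x \<in> K" if "x \<in> K" for x using that by (simp add: K_def J_eq_cscale C.h_scale_left)
    have "g (B x y) r = 0" "g (B x y) (J r) = 0" for x y
      using g_B_cyclic[of x y r] g_B_cyclic[of y r x] g_B_cyclic[of x y "J r"] g_B_cyclic[of y "J r" x] Br BJr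
      by (simp_all add: g_linear)
    then show "B x y \<in> K" for x y by (simp add: K_def cherm_def complex_eq_iff)
    fix x assume x: "x \<in> K" "\<forall>y\<in>K. g x y = 0"
    show "x = 0"
    proof (rule g_nondegenerate)
      fix y
      have "g x y = g x (cscale A (cherm A y r / cherm A r r) r) + g x (y - cscale A (cherm A y r / cherm A r r) r)"
        by (simp flip: g_linear)
      then show "g x y = 0" using x split gI by simp
    qed
  qed
  have "I \<inter> K = {0}"
  proof -
    have "x = 0" if "x \<in> I" "x \<in> K" for x
      using that rr by (auto simp: I_def K_def C.h_scale_left)
    moreover have "0 \<in> I" "0 \<in> K" using real_vector.subspace_0[OF sI] by (auto simp: K_def)
    ultimately show ?thesis by blast
  qed
  moreover have "{x + y |x y. x \<in> I \<and> y \<in> K} = UNIV"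
    using split by (auto simp: set_eq_iff) (metis add_diff_cancel_left' add_diff_eq)
  moreover have "\<forall>x\<in>I. \<forall>y\<in>K. g x y = 0" using gI g_sym by metis
  moreover have "r \<in> I" unfolding I_def by (rule range_eqI[of _ _ 1]) simp
  then have "I \<noteq> {0}" using r0 by auto
  ultimately have "K = {0}" using ind Iid Kid unfolding indecomposable_def by blast
  then show ?thesis using split(2)[of x] by auto
qed

end

section \<open>Recognising the model algebras\<close>

context phq
begin

lemma J_cscale: "J (cscale A c x) = cscale A (\<i> * c) x"
  by (simp add: J_eq_cscale)

text \<open>The factor $\epsilon$ covers a model and its opposite at once; the same device is used for the six-dimensional algebras below.\<close>

lemma equivalent_R:
  assumes M: "phq_lie_algebra M" "bracket M = bracket R_0_2" "cstr M = cstr R_0_2"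
    "metric M = (\<lambda>u v. \<epsilon> * metric R_0_2 u v)"
    and abelian: "\<And>x y. cprod A x y = 0" and e: "cherm A e e = of_real \<epsilon>" "\<And>x. \<exists>k. x = cscale A k e"
  shows "phq_equivalent A M"
proof (rule phq_equivalentI[OF M(1)])
  define f where "f u = cscale A (Complex (u $ 1) (u $ 2)) e" for u :: "real ^ 2"
  show "linear f" by (rule linearI) (simp_all add: f_def cscale_def algebra_simps)
  show "surj f"
  proof (rule surjI)
    fix x
    show "f (\<chi> i. if i = 1 then Re (SOME k. x = cscale A k e) else Im (SOME k. x = cscale A k e)) = x"
      using someI_ex[OF e(2)[of x]] by (simp add: f_def)
  qed
  fix u v
  have "Complex (cstr M u $ 1) (cstr M u $ 2) = \<i> * Complex (u $ 1) (u $ 2)"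
    by (simp add: M R_0_2_def cstr_of_def axis_def complex_eq_iff)
  then show "f (cstr M u) = J (f u)" by (simp add: f_def J_cscale)
  show "g (f u) (f v) = metric M u v"
    by (simp add: f_def Re_cherm C.h_expand e M R_0_2_def metric_of_def algebra_simps)
  have "cprod M u v = 0" by (simp add: cprod_def M R_0_2_def)
  then show "f (cprod M u v) = cprod A (f u) (f v)"
    by (simp add: abelian f_def cscale_def)
qed

definition frame3 :: "'a \<Rightarrow> 'a \<Rightarrow> 'a \<Rightarrow> real ^ l_index \<Rightarrow> 'a" where
  "frame3 e1 e2 e3 u = cscale A (Complex (u $ X1) (u $ JX1)) e1
     + cscale A (Complex (u $ X2) (u $ JX2)) e2 + cscale A (Complex (u $ X3) (u $ JX3)) e3"

definition frame4 :: "'a \<Rightarrow> 'a \<Rightarrow> 'a \<Rightarrow> 'a \<Rightarrow> real ^ t_index \<Rightarrow> 'a" where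
  "frame4 e1 e2 e3 e4 u = cscale A (Complex (u $ T1) (u $ T2)) e1
     + cscale A (Complex (u $ T3) (u $ T4)) e2
     + cscale A (Complex (u $ S1) (u $ S2)) e3 + cscale A (Complex (u $ S3) (u $ S4)) e4"

lemma linear_frame3: "linear (frame3 e1 e2 e3)"
  by (rule linearI) (simp_all add: frame3_def cscale_def algebra_simps)

lemma linear_frame4: "linear (frame4 e1 e2 e3 e4)"
  by (rule linearI) (simp_all add: frame4_def cscale_def algebra_simps)

lemma surj_frame3:
  assumes "C.spanned3 e1 e2 e3" shows "surj (frame3 e1 e2 e3)"
  unfolding surj_def
proof
  fix x
  obtain k1 k2 k3 where x: "x = cscale A k1 e1 + cscale A k2 e2 + cscale A k3 e3"
    using assms unfolding C.spanned3_iff by blast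
  have "x = frame3 e1 e2 e3 (\<chi> i. case i of X1 \<Rightarrow> Re k1 | JX1 \<Rightarrow> Im k1 | X2 \<Rightarrow> Re k2 | JX2 \<Rightarrow> Im k2
      | X3 \<Rightarrow> Re k3 | JX3 \<Rightarrow> Im k3)"
    by (simp add: frame3_def x)
  then show "\<exists>u. x = frame3 e1 e2 e3 u" ..
qed

lemma surj_frame4:
  assumes "C.spanned4 e1 e2 e3 e4" shows "surj (frame4 e1 e2 e3 e4)"
  unfolding surj_def
proof
  fix x
  obtain k1 k2 k3 k4 where
    x: "x = cscale A k1 e1 + cscale A k2 e2 + cscale A k3 e3 + cscale A k4 e4"
    using assms unfolding C.spanned4_iff by blast
  have "x = frame4 e1 e2 e3 e4 (\<chi> i. case i of T1 \<Rightarrow> Re k1 | T2 \<Rightarrow> Im k1 | T3 \<Rightarrow> Re k2 | T4 \<Rightarrow> Im k2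
      | S1 \<Rightarrow> Re k3 | S2 \<Rightarrow> Im k3 | S3 \<Rightarrow> Re k4 | S4 \<Rightarrow> Im k4)"
    by (simp add: frame4_def x)
  then show "\<exists>u. x = frame4 e1 e2 e3 e4 u" ..
qed

lemma equivalent_L:
  assumes M: "phq_lie_algebra M" "bracket M = bracket L_2_4" "cstr M = cstr L_2_4"
    "metric M = (\<lambda>u v. \<epsilon> * metric L_2_4 u v)"
    and sp: "C.spanned3 e1 e2 e3"
    and h: "cherm A e1 e1 = 0" "cherm A e1 e2 = 0" "cherm A e1 e3 = of_real \<epsilon>"
      "cherm A e2 e2 = of_real \<epsilon>" "cherm A e2 e3 = 0" "cherm A e3 e3 = 0"
    and p: "cprod A e1 e2 = cscale A (- \<i>) e3" "cprod A e1 e3 = 0" "cprod A e2 e3 = 0"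
  shows "phq_equivalent A M"
proof (rule phq_equivalentI[OF M(1) linear_frame3 surj_frame3[OF sp]])
  have h': "cherm A e2 e1 = 0" "cherm A e3 e1 = of_real \<epsilon>" "cherm A e3 e2 = 0"
    using h C.h_sym[of e2 e1] C.h_sym[of e3 e1] C.h_sym[of e3 e2] by simp_all
  have p': "cprod A e2 e1 = cscale A \<i> e3" "cprod A e3 e1 = 0" "cprod A e3 e2 = 0"
    using p C.br_skew[of e2 e1] C.br_skew[of e3 e1] C.br_skew[of e3 e2] by simp_all
  fix u v
  let ?f = "frame3 e1 e2 e3"
  have "Complex (cstr M u $ X1) (cstr M u $ JX1) = \<i> * Complex (u $ X1) (u $ JX1)"
    "Complex (cstr M u $ X2) (cstr M u $ JX2) = \<i> * Complex (u $ X2) (u $ JX2)"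
    "Complex (cstr M u $ X3) (cstr M u $ JX3) = \<i> * Complex (u $ X3) (u $ JX3)"
    by (simp_all add: M L_2_4_def cstr_of_def axis_def complex_eq_iff)
  then show "?f (cstr M u) = J (?f u)" by (simp add: frame3_def J_linear J_cscale)
  show "g (?f u) (?f v) = metric M u v"
    by (simp add: frame3_def Re_cherm C.h_expand h h' M L_2_4_def metric_of_def algebra_simps)
  have "cprod A (cscale A a1 e1 + cscale A a2 e2 + cscale A a3 e3)
      (cscale A b1 e1 + cscale A b2 e2 + cscale A b3 e3) = cscale A (- \<i> * (a1 * b2 - a2 * b1)) e3"
    for a1 a2 a3 b1 b2 b3
    by (simp add: C.br_expand p p' C.scale_left_diff_distrib algebra_simps)
  moreover have "cprod M u v $ i = 0" if "i \<noteq> X3" "i \<noteq> JX3" for i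
    using that by (cases i) (simp_all add: cprod_def M L_2_4_def bracket_of_def cstr_of_def axis_def)
  moreover have "Complex (cprod M u v $ X3) (cprod M u v $ JX3) =
      - \<i> * (Complex (u $ X1) (u $ JX1) * Complex (v $ X2) (v $ JX2)
           - Complex (u $ X2) (u $ JX2) * Complex (v $ X1) (v $ JX1))"
    by (simp add: cprod_def M L_2_4_def bracket_of_def cstr_of_def axis_def complex_eq_iff algebra_simps)
  ultimately show "?f (cprod M u v) = cprod A (?f u) (?f v)"
    by (simp add: frame3_def flip: zero_complex.code)
qed

context
  fixes e1 e2 e3 e4
  assumes sp: "C.spanned4 e1 e2 e3 e4"
    and h: "cherm A e1 e1 = 0" "cherm A e1 e2 = 0" "cherm A e1 e3 = 1" "cherm A e1 e4 = 0"
      "cherm A e2 e2 = 0" "cherm A e2 e3 = 0" "cherm A e2 e4 = 1" "cherm A e3 e3 = 0"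
      "cherm A e3 e4 = 0" "cherm A e4 e4 = 0"
begin

lemma cherm_table: "cherm A e2 e1 = 0" "cherm A e3 e1 = 1" "cherm A e4 e1 = 0"
  "cherm A e3 e2 = 0" "cherm A e4 e2 = 1" "cherm A e4 e3 = 0"
  using h C.h_sym[of e2 e1] C.h_sym[of e3 e1] C.h_sym[of e4 e1] C.h_sym[of e3 e2]
    C.h_sym[of e4 e2] C.h_sym[of e4 e3] by simp_all

lemma equivalent_frame4:
  assumes M: "phq_lie_algebra M"
    "cstr M = cstr_of [(T1, T2), (T3, T4), (S1, S2), (S3, S4)]"
    "metric M = metric_of [(T1, S1), (T2, S2), (T3, S3), (T4, S4)]"
    and p: "\<And>u v. frame4 e1 e2 e3 e4 (cprod M u v) = cprod A (frame4 e1 e2 e3 e4 u) (frame4 e1 e2 e3 e4 v)"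
  shows "phq_equivalent A M"
proof (rule phq_equivalentI[OF M(1) linear_frame4 surj_frame4[OF sp] _ _ p])
  fix u v
  let ?f = "frame4 e1 e2 e3 e4"
  have "Complex (cstr M u $ T1) (cstr M u $ T2) = \<i> * Complex (u $ T1) (u $ T2)"
    "Complex (cstr M u $ T3) (cstr M u $ T4) = \<i> * Complex (u $ T3) (u $ T4)"
    "Complex (cstr M u $ S1) (cstr M u $ S2) = \<i> * Complex (u $ S1) (u $ S2)"
    "Complex (cstr M u $ S3) (cstr M u $ S4) = \<i> * Complex (u $ S3) (u $ S4)"
    by (simp_all add: M cstr_of_def axis_def complex_eq_iff)
  then show "?f (cstr M u) = J (?f u)" by (simp add: frame4_def J_linear J_cscale)
  show "g (?f u) (?f v) = metric M u v"
    by (simp add: frame4_def Re_cherm C.h_expand h cherm_table M metric_of_def algebra_simps)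
qed

lemma equivalent_Tstar_0:
  assumes p: "cprod A e1 e2 = 0" "cprod A e1 e3 = 0" "cprod A e1 e4 = cscale A (- \<i>) e3"
    "cprod A e2 e3 = 0" "cprod A e2 e4 = 0" "cprod A e3 e4 = 0"
  shows "phq_equivalent A Tstar_0"
proof (rule equivalent_frame4[OF phq_Tstar_0])
  have p': "cprod A e2 e1 = 0" "cprod A e3 e1 = 0" "cprod A e4 e1 = cscale A \<i> e3"
    "cprod A e3 e2 = 0" "cprod A e4 e2 = 0" "cprod A e4 e3 = 0"
    using p C.br_skew[of e2 e1] C.br_skew[of e3 e1] C.br_skew[of e4 e1] C.br_skew[of e3 e2]
      C.br_skew[of e4 e2] C.br_skew[of e4 e3] by simp_all
  fix u v
  let ?f = "frame4 e1 e2 e3 e4"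
  have "cprod A (cscale A a1 e1 + cscale A a2 e2 + cscale A a3 e3 + cscale A a4 e4)
      (cscale A b1 e1 + cscale A b2 e2 + cscale A b3 e3 + cscale A b4 e4)
      = cscale A (- \<i> * (a1 * b4 - a4 * b1)) e3" for a1 a2 a3 a4 b1 b2 b3 b4
    by (simp add: C.br_expand p p' C.scale_left_diff_distrib algebra_simps)
  moreover have "cprod Tstar_0 u v $ i = 0" if "i \<noteq> S1" "i \<noteq> S2" for i
    using that by (cases i) (simp_all add: cprod_def Tstar_0_def bracket_of_def cstr_of_def axis_def)
  moreover have "Complex (cprod Tstar_0 u v $ S1) (cprod Tstar_0 u v $ S2) =
      - \<i> * (Complex (u $ T1) (u $ T2) * Complex (v $ S3) (v $ S4)
           - Complex (u $ S3) (u $ S4) * Complex (v $ T1) (v $ T2))"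
    by (simp add: cprod_def Tstar_0_def bracket_of_def cstr_of_def axis_def complex_eq_iff algebra_simps)
  ultimately show "?f (cprod Tstar_0 u v) = cprod A (?f u) (?f v)"
    by (simp add: frame4_def flip: zero_complex.code)
qed (simp_all add: Tstar_0_def)

lemma equivalent_Tstar_theta3:
  assumes p: "cprod A e1 e2 = cscale A \<i> e4" "cprod A e1 e3 = 0" "cprod A e1 e4 = cscale A (- \<i>) e3"
    "cprod A e2 e3 = 0" "cprod A e2 e4 = 0" "cprod A e3 e4 = 0"
  shows "phq_equivalent A Tstar_theta3"
proof (rule equivalent_frame4[OF phq_Tstar_theta3])
  have p': "cprod A e2 e1 = cscale A (- \<i>) e4" "cprod A e3 e1 = 0" "cprod A e4 e1 = cscale A \<i> e3"
    "cprod A e3 e2 = 0" "cprod A e4 e2 = 0" "cprod A e4 e3 = 0"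
    using p C.br_skew[of e2 e1] C.br_skew[of e3 e1] C.br_skew[of e4 e1] C.br_skew[of e3 e2]
      C.br_skew[of e4 e2] C.br_skew[of e4 e3] by simp_all
  fix u v
  let ?f = "frame4 e1 e2 e3 e4"
  have "cprod A (cscale A a1 e1 + cscale A a2 e2 + cscale A a3 e3 + cscale A a4 e4)
      (cscale A b1 e1 + cscale A b2 e2 + cscale A b3 e3 + cscale A b4 e4)
      = cscale A (- \<i> * (a1 * b4 - a4 * b1)) e3 + cscale A (\<i> * (a1 * b2 - a2 * b1)) e4"
    for a1 a2 a3 a4 b1 b2 b3 b4
    by (simp add: C.br_expand p p' C.scale_left_diff_distrib algebra_simps)
  moreover have "cprod Tstar_theta3 u v $ i = 0" if "i \<in> {T1, T2, T3, T4}" for i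
    using that by (auto simp: cprod_def Tstar_theta3_def bracket_of_def cstr_of_def axis_def)
  moreover have "Complex (cprod Tstar_theta3 u v $ S1) (cprod Tstar_theta3 u v $ S2) =
      - \<i> * (Complex (u $ T1) (u $ T2) * Complex (v $ S3) (v $ S4)
           - Complex (u $ S3) (u $ S4) * Complex (v $ T1) (v $ T2))"
    "Complex (cprod Tstar_theta3 u v $ S3) (cprod Tstar_theta3 u v $ S4) =
      \<i> * (Complex (u $ T1) (u $ T2) * Complex (v $ T3) (v $ T4)
           - Complex (u $ T3) (u $ T4) * Complex (v $ T1) (v $ T2))"
    by (simp_all add: cprod_def Tstar_theta3_def bracket_of_def cstr_of_def axis_def complex_eq_iff algebra_simps)
  ultimately show "?f (cprod Tstar_theta3 u v) = cprod A (?f u) (?f v)"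
    by (simp add: frame4_def flip: zero_complex.code)
qed (simp_all add: Tstar_theta3_def)

end

end

section \<open>The model algebras are pairwise inequivalent\<close>

lemma phq_equivalent_common:
  fixes B :: "'b::real_vector phq_algebra" and C :: "'c::real_vector phq_algebra"
  assumes "phq_equivalent A B" "phq_equivalent A C"
  shows "phq_equivalent B C"
proof -
  obtain f where f: "linear f" "bij f" "\<And>x y. f (bracket A x y) = bracket B (f x) (f y)"
    "\<And>x. cstr B (f x) = f (cstr A x)" "\<And>x y. metric B (f x) (f y) = metric A x y"
    using assms(1) unfolding phq_equivalent_def by blast
  obtain k where k: "linear k" "bij k" "\<And>x y. k (bracket A x y) = bracket C (k x) (k y)"
    "\<And>x. cstr C (k x) = k (cstr A x)" "\<And>x y. metric C (k x) (k y) = metric A x y"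
    using assms(2) unfolding phq_equivalent_def by blast
  have inv: "inv f (f u) = u" "f (inv f x) = x" for u x
    using f(2) by (simp_all add: bij_is_inj bij_is_surj surj_f_inv_f)
  have li: "linear (inv f)"
    by (rule linearI) (metis inv linear_add[OF f(1)], metis inv linear_cmul[OF f(1)])
  have "inv f (bracket B x y) = bracket A (inv f x) (inv f y)" for x y by (metis f(3) inv)
  moreover have "cstr A (inv f x) = inv f (cstr B x)" for x by (metis f(4) inv)
  moreover have "metric A (inv f x) (inv f y) = metric B x y" for x y by (metis f(5) inv)
  moreover have "linear (k \<circ> inv f)" by (rule linear_compose[OF li k(1)])
  moreover have "bij (k \<circ> inv f)" using f(2) k(2) bij_comp bij_imp_bij_inv by blast
  ultimately show ?thesis
    unfolding phq_equivalent_def by (intro exI[of _ "k \<circ> inv f"]) (simp add: k)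
qed

lemma phq_equivalent_DIM:
  fixes B :: "'b::euclidean_space phq_algebra" and C :: "'c::euclidean_space phq_algebra"
  assumes "phq_equivalent B C"
  shows "DIM('b) = DIM('c)"
proof -
  obtain f :: "'b \<Rightarrow> 'c" where f: "linear f" "bij f" using assms unfolding phq_equivalent_def by blast
  have "dim (f ` UNIV) = dim (UNIV :: 'b set)"
    using f by (intro dim_image_eq) (auto simp: bij_is_inj)
  then show ?thesis using f by (simp add: bij_is_surj)
qed

lemma CARD_l_index: "CARD(l_index) = 6"
  by (simp add: UNIV_l_index)

lemma CARD_t_index: "CARD(t_index) = 8"
  by (simp add: UNIV_t_index)

lemma not_equivalent_R: "\<not> phq_equivalent R_0_2 R_2_0"
proof
  assume "phq_equivalent R_0_2 R_2_0"
  then obtain f where "\<And>x y. metric R_2_0 (f x) (f y) = metric R_0_2 x y"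
    unfolding phq_equivalent_def by blast
  from this[of "bas 1" "bas 1"] have "- ((f (bas 1) $ 1)\<^sup>2 + (f (bas 1) $ 2)\<^sup>2) = 1"
    by (simp add: R_2_0_def R_0_2_def opposite_def metric_of_def axis_def power2_eq_square)
  then show False by (smt (verit) zero_le_power2)
qed

text \<open>The squares $g([x,y],[x,y])$ are nonnegative for one metric and nonpositive for the other, and not all zero.\<close>

lemma not_equivalent_L: "\<not> phq_equivalent L_2_4 L_4_2"
proof
  assume "phq_equivalent L_2_4 L_4_2"
  then obtain f where f: "\<And>x y. metric L_4_2 (f x) (f y) = metric L_2_4 x y"
    "\<And>x y. f (bracket L_2_4 x y) = bracket L_4_2 (f x) (f y)"
    unfolding phq_equivalent_def by blast
  let ?b = "\<lambda>A. \<lambda>x y. metric A (bracket A x y) (bracket A x y)"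
  have "?b L_4_2 u v \<le> 0" for u v
    by (simp add: L_4_2_def L_2_4_def opposite_def metric_of_def bracket_of_def axis_def)
  moreover have "?b L_2_4 (bas X1) (bas JX1) = 1"
    by (simp add: L_2_4_def metric_of_def bracket_of_def axis_def)
  ultimately show False using f by (metis not_one_le_zero)
qed

text \<open>One algebra is two-step nilpotent, the other is not.\<close>

lemma not_equivalent_Tstar: "\<not> phq_equivalent Tstar_0 Tstar_theta3"
proof
  assume "phq_equivalent Tstar_0 Tstar_theta3"
  then obtain f where f: "linear f" "bij f"
    "\<And>x y. f (bracket Tstar_0 x y) = bracket Tstar_theta3 (f x) (f y)"
    unfolding phq_equivalent_def by blast
  obtain x y where xy: "f x = bas T1" "f y = bas T2" using f(2) by (metis bij_pointE)
  have "bracket Tstar_0 x (bracket Tstar_0 x y) = 0"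
    by (simp add: Tstar_0_def bracket_of_def axis_def)
  then have "bracket Tstar_theta3 (bas T1) (bracket Tstar_theta3 (bas T1) (bas T2)) = 0"
    using f(3) xy linear_0[OF f(1)] by metis
  then have "bas S4 = (0 :: real ^ t_index)"
    by (simp add: Tstar_theta3_def bracket_of_def axis_def)
  then show False by simp
qed

lemma at_most_one_model:
  "\<not> (phq_equivalent A R_0_2 \<and> phq_equivalent A R_2_0)"
  "\<not> (phq_equivalent A L_2_4 \<and> phq_equivalent A L_4_2)"
  "\<not> (phq_equivalent A Tstar_0 \<and> phq_equivalent A Tstar_theta3)"
  "\<And>(P :: (real ^ 2) phq_algebra) (Q :: (real ^ l_index) phq_algebra).
     \<not> (phq_equivalent A P \<and> phq_equivalent A Q)"
  "\<And>(P :: (real ^ 2) phq_algebra) (Q :: (real ^ t_index) phq_algebra).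
     \<not> (phq_equivalent A P \<and> phq_equivalent A Q)"
  "\<And>(P :: (real ^ l_index) phq_algebra) (Q :: (real ^ t_index) phq_algebra).
     \<not> (phq_equivalent A P \<and> phq_equivalent A Q)"
proof -
  show "\<not> (phq_equivalent A R_0_2 \<and> phq_equivalent A R_2_0)"
    using phq_equivalent_common[of A R_0_2 R_2_0] not_equivalent_R by blast
  show "\<not> (phq_equivalent A L_2_4 \<and> phq_equivalent A L_4_2)"
    using phq_equivalent_common[of A L_2_4 L_4_2] not_equivalent_L by blast
  show "\<not> (phq_equivalent A Tstar_0 \<and> phq_equivalent A Tstar_theta3)"
    using phq_equivalent_common[of A Tstar_0 Tstar_theta3] not_equivalent_Tstar by blast
  fix P :: "(real ^ 2) phq_algebra" and Q :: "(real ^ l_index) phq_algebra"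
    and R :: "(real ^ t_index) phq_algebra"
  have "\<not> phq_equivalent P Q" "\<not> phq_equivalent P R" "\<not> phq_equivalent Q R"
    using phq_equivalent_DIM[of P Q] phq_equivalent_DIM[of P R] phq_equivalent_DIM[of Q R]
    by (auto simp: CARD_l_index CARD_t_index)
  then show "\<not> (phq_equivalent A P \<and> phq_equivalent A Q)"
    "\<not> (phq_equivalent A P \<and> phq_equivalent A R)" "\<not> (phq_equivalent A Q \<and> phq_equivalent A R)"
    using phq_equivalent_common[of A P Q] phq_equivalent_common[of A P R]
      phq_equivalent_common[of A Q R] by blast+
qed

section \<open>The classification\<close>

lemma (in phq) equivalent_to_model:
  assumes small: "small_hermitian_lie (cscale A) (cprod A) (cadj A) (cherm A)"
    and nz: "\<exists>x::'a. x \<noteq> 0" and nil: "nilpotent A"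
  shows "phq_equivalent A R_0_2 \<or> phq_equivalent A R_2_0 \<or> phq_equivalent A L_4_2 \<or>
    phq_equivalent A L_2_4 \<or> phq_equivalent A Tstar_0 \<or> phq_equivalent A Tstar_theta3"
proof -
  interpret S: small_hermitian_lie "cscale A" "cprod A" "cadj A" "cherm A" by (rule small)
  consider (abelian) "\<And>x y. cprod A x y = 0"
    | (two_step) a b where "cprod A a b \<noteq> 0" "\<And>v x y. cprod A v (cprod A x y) = 0"
    | (higher) u v w where "cprod A u (cprod A v w) \<noteq> 0"
    by blast
  then show ?thesis
  proof cases
    case abelian
    obtain e \<epsilon> where e: "\<epsilon> = 1 \<or> \<epsilon> = - 1" "cherm A e e = of_real \<epsilon>" "\<And>x. \<exists>k. x = cscale A k e"
      by (rule S.abelian_basis[OF abelian nz]) blast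
    from e(1) show ?thesis
    proof
      assume "\<epsilon> = 1"
      then have "phq_equivalent A R_0_2"
        by (intro equivalent_R[OF phq_R_0_2 _ _ _ abelian e(2,3)]) simp_all
      then show ?thesis by simp
    next
      assume "\<epsilon> = - 1"
      then have "phq_equivalent A R_2_0"
        by (intro equivalent_R[OF phq_R_2_0 _ _ _ abelian e(2,3)]) (simp_all add: R_2_0_def opposite_def)
      then show ?thesis by simp
    qed
  next
    case two_step
    show ?thesis
    proof (cases "C.spanned3 a b (cprod A a b)")
      case True
      obtain e1 e2 e3 \<epsilon> where eps: "\<epsilon> = 1 \<or> \<epsilon> = - 1" and sp: "C.spanned3 e1 e2 e3"
        and t: "cherm A e1 e1 = 0" "cherm A e1 e2 = 0" "cherm A e1 e3 = of_real \<epsilon>"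
          "cherm A e2 e2 = of_real \<epsilon>" "cherm A e2 e3 = 0" "cherm A e3 e3 = 0"
          "cprod A e1 e2 = cscale A (- \<i>) e3" "cprod A e1 e3 = 0" "cprod A e2 e3 = 0"
        by (rule S.heisenberg3[OF two_step(2) refl two_step(1) True])
      from eps show ?thesis
      proof
        assume "\<epsilon> = 1"
        then have "phq_equivalent A L_2_4"
          by (intro equivalent_L[OF phq_L_2_4 _ _ _ sp t]) simp_all
        then show ?thesis by simp
      next
        assume "\<epsilon> = - 1"
        then have "phq_equivalent A L_4_2"
          by (intro equivalent_L[OF phq_L_4_2 _ _ _ sp t]) (simp_all add: L_4_2_def opposite_def)
        then show ?thesis by simp
      qed
    next
      case False
      show ?thesis
        by (rule S.heisenberg4[OF two_step(2) refl two_step(1) False])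
           (use equivalent_Tstar_0 in blast)
    qed
  next
    case higher
    obtain k where "C.left_normed k \<subseteq> {0}" using left_normed_nilpotent[OF nil] .
    then obtain p q x where pq: "cprod A x (cprod A p q) \<noteq> 0"
        "\<And>v x. cprod A v (cprod A x (cprod A p q)) = 0"
      using C.last_noncentral_bracket[OF _ higher] by metis
    obtain e f2 f3 f4 where f: "C.spanned4 e f2 f3 f4" "cprod A e f2 = f3" "cprod A e f3 = f4"
        "cprod A f2 f3 = 0" "\<And>x. cprod A x f4 = 0" "f4 \<noteq> 0"
      by (rule S.filiform_basis[OF pq]) blast
    show ?thesis
      by (rule S.filiform4[OF f]) (use equivalent_Tstar_theta3 in blast)
  qed
qed

theorem theorem3p6:
  fixes A :: "'a::real_vector phq_algebra" and n :: nat
  assumes "\<exists>B::'a set. finite B \<and> span B = UNIV"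
    and "dim (UNIV :: 'a set) = n"
    and "n \<le> 8"
    and "\<exists>x::'a. x \<noteq> 0"
    and "phq_lie_algebra A"
    and "nilpotent A"
    and "indecomposable A"
  shows "\<exists>!i. i < 6 \<and>
    [phq_equivalent A R_0_2,
     phq_equivalent A R_2_0,
     phq_equivalent A L_4_2,
     phq_equivalent A L_2_4,
     phq_equivalent A Tstar_0,
     phq_equivalent A Tstar_theta3] ! i"
proof -
  interpret phq A by unfold_locales (rule assms(5))
  obtain S :: "'a set" where S: "finite S" "span S = UNIV" using assms(1) by blast
  have d: "dim (UNIV :: 'a set) \<le> 8" using assms(2,3) by simp
  have "small_hermitian_lie (cscale A) (cprod A) (cadj A) (cherm A)"
    by unfold_locales (use spanned4_if_indep4[OF S d] no_orthogonal_summand[OF assms(7)] in blast)+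
  then have ex: "phq_equivalent A R_0_2 \<or> phq_equivalent A R_2_0 \<or> phq_equivalent A L_4_2 \<or>
    phq_equivalent A L_2_4 \<or> phq_equivalent A Tstar_0 \<or> phq_equivalent A Tstar_theta3"
    by (rule equivalent_to_model) (rule assms)+
  have index: "i = 0 \<and> phq_equivalent A R_0_2 \<or> i = 1 \<and> phq_equivalent A R_2_0 \<or>
      i = 2 \<and> phq_equivalent A L_4_2 \<or> i = 3 \<and> phq_equivalent A L_2_4 \<or>
      i = 4 \<and> phq_equivalent A Tstar_0 \<or> i = 5 \<and> phq_equivalent A Tstar_theta3"
    if "i < 6 \<and> [phq_equivalent A R_0_2, phq_equivalent A R_2_0, phq_equivalent A L_4_2,
        phq_equivalent A L_2_4, phq_equivalent A Tstar_0, phq_equivalent A Tstar_theta3] ! i" for i :: nat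
  proof -
    have "i = 0 \<or> i = 1 \<or> i = 2 \<or> i = 3 \<or> i = 4 \<or> i = 5" using that by linarith
    then show ?thesis using that by (elim disjE) simp_all
  qed
  show ?thesis
  proof (rule ex_ex1I)
    show "\<exists>i. i < 6 \<and> [phq_equivalent A R_0_2, phq_equivalent A R_2_0, phq_equivalent A L_4_2,
        phq_equivalent A L_2_4, phq_equivalent A Tstar_0, phq_equivalent A Tstar_theta3] ! i"
      (is "\<exists>i. ?P i")
    proof -
      have "?P 0 \<or> ?P 1 \<or> ?P 2 \<or> ?P 3 \<or> ?P 4 \<or> ?P 5" using ex by simp
      then show ?thesis by blast
    qed
  next
    fix i j :: nat
    assume "i < 6 \<and> [phq_equivalent A R_0_2, phq_equivalent A R_2_0, phq_equivalent A L_4_2,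
        phq_equivalent A L_2_4, phq_equivalent A Tstar_0, phq_equivalent A Tstar_theta3] ! i"
      "j < 6 \<and> [phq_equivalent A R_0_2, phq_equivalent A R_2_0, phq_equivalent A L_4_2,
        phq_equivalent A L_2_4, phq_equivalent A Tstar_0, phq_equivalent A Tstar_theta3] ! j"
    from index[OF this(1)] index[OF this(2)] show "i = j"
      using at_most_one_model[of A] by (elim disjE conjE) (simp | blast)+
  qed
qed

end
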